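(* Let $L$ be a flat linear transport of class $C^1$ over a real differentiable manifold $M$ (of class at least $C^2$), and let $x_0\in M$. In a neighborhood of $x_0$ there exists a field of holonomic bases of the tangent bundle in which the components of the bivector $H(x,y)$ of $L$ are constant if and only if in a neighborhood of $x_0$ there exist local coordinates $\{x^i\}$ such that the components, referred to the associated basis $\{\partial/\partial x^i\}$, of one, and hence of every, matrix $F_x=[(F_x)^{i}{}_{j}]$ defining $L$ in that basis through $\mathbf{H}(y,x)=F_y^{-1}F_x$ satisfy $$\frac{\partial(F_x)^{i}{}_{j}}{\partial x^k}-\frac{\partial(F_x)^{i}{}_{k}}{\partial x^j}=0\qquad\text{for all }i,j,k.$$ Moreover, if such coordinates exist, then any local field of bases around $x_0$ in which the components of $H(x,y)$ are constant is holonomic (in a neighborhood of $x_0$).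
   Context: $T^{p,q}_x(M)$ is the space of tensors of type $(p,q)$ at $x$. A flat linear transport (of tensors) over $M$ is a map $L:(x,y)\mapsto L_{x\to y}$, $x,y\in M$, where $L_{x\to y}$ maps tensors at $x$ to tensors at $y$, such that for all $x,y,z\in M$ and all types: (i) $L_{x\to y}(T^{p,q}_x(M))\subseteq T^{p,q}_y(M)$; (ii) $L_{x\to y}$ is linear on each $T^{p,q}_x(M)$; (iii) $L_{x\to y}(A_1\otimes A_2)=(L_{x\to y}A_1)\otimes(L_{x\to y}A_2)$; (iv) $L_{x\to y}\circ C=C\circ L_{x\to y}$ for every contraction operator $C$; (v) $L_{y\to z}\circ L_{x\to y}=L_{x\to z}$; (vi) $L_{x\to x}=\mathrm{id}$. In a field of bases $\{E_i\}$ with dual bases $\{E^i\}$ the components $H^{i}{}_{j}(y,x)$ are defined by $L_{x\to y}(E_j(x))=H^{i}{}_{j}(y,x)E_i(y)$; the bivector of $L$ is $H(y,x)=H^{i}{}_{j}(y,x)E_i(y)\otimes E^j(x)$ and $\mathbf{H}(y,x)=[H^{i}{}_{j}(y,x)]$ (superscript = row index). $L$ is of class $C^1$ if in local coordinate bases these components are $C^1$ in $(y,x)$. There always exist nondegenerate matrices $F_x$ with $\mathbf{H}(y,x)=F_y^{-1}F_x$, and they are determined up to $F_x\mapsto DF_x$ with $D$ a constant nondegenerate matrix. "Constant" means independent of $x$ and $y$. A local field of bases is holonomic if it is generated by local coordinates, i.e. of the form $\{\partial/\partial\tilde x^i\}$ for some local coordinates $\{\tilde x^i\}$ of $M$. 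*)

theory Defs
  imports "HOL-Analysis.Analysis" "HOL-Library.Extended_Nat"
begin

section \<open>Functions of class C^k on open sets\<close>

primrec Ck_on :: "nat \<Rightarrow> ('v::real_normed_vector \<Rightarrow> 'w::real_normed_vector) \<Rightarrow> 'v set \<Rightarrow> bool" where
  "Ck_on 0 f S \<longleftrightarrow> continuous_on S f"
| "Ck_on (Suc k) f S \<longleftrightarrow> (\<forall>u\<in>S. f differentiable (at u)) \<and>
     (\<forall>v. Ck_on k (\<lambda>u. frechet_derivative f (at u) v) S)"

definition class_on :: "enat \<Rightarrow> ('v::real_normed_vector \<Rightarrow> 'w::real_normed_vector) \<Rightarrow> 'v set \<Rightarrow> bool" where
  "class_on r f S \<longleftrightarrow> (\<forall>k. enat k \<le> r \<longrightarrow> Ck_on k f S)"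

section \<open>Manifolds of class C^r and their local coordinates\<close>

text \<open>A chart is a pair of a domain and a coordinate map; the values of the map outside the
  domain are irrelevant.\<close>

type_synonym ('a, 'n) chart = "'a set \<times> ('a \<Rightarrow> real ^ 'n)"

abbreviation dom_of :: "('a, 'n) chart \<Rightarrow> 'a set" where "dom_of \<equiv> fst"
abbreviation map_of_chart :: "('a, 'n) chart \<Rightarrow> 'a \<Rightarrow> real ^ 'n" where "map_of_chart \<equiv> snd"

definition img_of :: "('a, 'n) chart \<Rightarrow> (real ^ 'n) set" where
  "img_of c = map_of_chart c ` dom_of c"

definition point_of :: "('a, 'n) chart \<Rightarrow> real ^ 'n \<Rightarrow> 'a" where
  "point_of c = inv_into (dom_of c) (map_of_chart c)"

definition is_chart :: "'a topology \<Rightarrow> ('a, 'n::finite) chart \<Rightarrow> bool" where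
  "is_chart M c \<longleftrightarrow> openin M (dom_of c) \<and> open (img_of c) \<and>
     homeomorphic_map (subtopology M (dom_of c)) (top_of_set (img_of c)) (map_of_chart c)"

definition compatible :: "enat \<Rightarrow> ('a, 'n::finite) chart \<Rightarrow> ('a, 'n) chart \<Rightarrow> bool" where
  "compatible r c d \<longleftrightarrow>
     class_on r (map_of_chart d \<circ> point_of c) (map_of_chart c ` (dom_of c \<inter> dom_of d)) \<and>
     class_on r (map_of_chart c \<circ> point_of d) (map_of_chart d ` (dom_of c \<inter> dom_of d))"

text \<open>Second countability is not demanded.\<close>

definition manifold :: "enat \<Rightarrow> 'a topology \<Rightarrow> ('a, 'n::finite) chart set \<Rightarrow> bool" where
  "manifold r M \<A> \<longleftrightarrow> Hausdorff_space M \<and>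
     (\<forall>c\<in>\<A>. is_chart M c) \<and> (\<Union>c\<in>\<A>. dom_of c) = topspace M \<and>
     (\<forall>c\<in>\<A>. \<forall>d\<in>\<A>. compatible r c d)"

text \<open>Local coordinates of a manifold of class C^r with r at least 2 are taken in its underlying
  C^2 structure: the coordinates obtained by integrating C^1 data are in general only of
  class C^2.\<close>

definition coords :: "'a topology \<Rightarrow> ('a, 'n::finite) chart set \<Rightarrow> ('a, 'n) chart set" where
  "coords M \<A> = {c. is_chart M c \<and> (\<forall>d\<in>\<A>. compatible 2 c d)}"

definition coords_at :: "'a topology \<Rightarrow> ('a, 'n::finite) chart set \<Rightarrow> 'a \<Rightarrow> ('a, 'n) chart set" where
  "coords_at M \<A> x = {c \<in> coords M \<A>. x \<in> dom_of c}"

text \<open>The entry in row \<open>i\<close>, column \<open>j\<close> of \<open>jac d c x\<close> is the partial derivative of the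
  \<open>i\<close>-th coordinate of \<open>d\<close> with respect to the \<open>j\<close>-th coordinate of \<open>c\<close>.\<close>

definition jac :: "('a, 'n::finite) chart \<Rightarrow> ('a, 'n) chart \<Rightarrow> 'a \<Rightarrow> real ^ 'n ^ 'n" where
  "jac d c x = jacobian (map_of_chart d \<circ> point_of c) (at (map_of_chart c x))"

section \<open>Tensors\<close>

text \<open>A tensor at \<open>x\<close> is given by its components in all local coordinates around \<open>x\<close>, subject to
  the usual transformation law. \<open>T c I J\<close> is the component in the coordinates \<open>c\<close> with list of
  contravariant indices \<open>I\<close> and list of covariant indices \<open>J\<close>; it is zero where it has
  no meaning.\<close>

type_synonym ('a, 'n) tensor = "('a, 'n) chart \<Rightarrow> 'n list \<Rightarrow> 'n list \<Rightarrow> real"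

definition tensors ::
  "'a topology \<Rightarrow> ('a, 'n::finite) chart set \<Rightarrow> nat \<Rightarrow> nat \<Rightarrow> 'a \<Rightarrow> ('a, 'n) tensor set" where
  "tensors M \<A> p q x = {T.
     (\<forall>c I J. \<not> (c \<in> coords_at M \<A> x \<and> length I = p \<and> length J = q) \<longrightarrow> T c I J = 0) \<and>
     (\<forall>c\<in>coords_at M \<A> x. \<forall>d\<in>coords_at M \<A> x. \<forall>I J. length I = p \<and> length J = q \<longrightarrow>
        T d I J = (\<Sum>K | length K = p. \<Sum>R | length R = q.
          (\<Prod>a<p. jac d c x $ (I ! a) $ (K ! a)) *
          (\<Prod>b<q. jac c d x $ (R ! b) $ (J ! b)) * T c K R))}"

definition lin_comb2 ::
  "real \<Rightarrow> ('a, 'n) tensor \<Rightarrow> real \<Rightarrow> ('a, 'n) tensor \<Rightarrow> ('a, 'n) tensor" where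
  "lin_comb2 s S t T = (\<lambda>c I J. s * S c I J + t * T c I J)"

definition lin_comb :: "real ^ 'n \<Rightarrow> ('n::finite \<Rightarrow> ('a, 'n) tensor) \<Rightarrow> ('a, 'n) tensor" where
  "lin_comb a e = (\<lambda>c I J. \<Sum>i\<in>UNIV. a $ i * e i c I J)"

text \<open>The numbers \<open>p\<close> and \<open>q\<close> are those of the type of the left factor \<open>S\<close>.\<close>

definition tensor_prod ::
  "nat \<Rightarrow> nat \<Rightarrow> ('a, 'n) tensor \<Rightarrow> ('a, 'n) tensor \<Rightarrow> ('a, 'n) tensor" where
  "tensor_prod p q S T = (\<lambda>c I J. S c (take p I) (take q J) * T c (drop p I) (drop q J))"

text \<open>Contraction of the contravariant index at position \<open>a\<close> with the covariant index at
  position \<open>b\<close>, positions being counted from 0.\<close>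

definition contraction :: "nat \<Rightarrow> nat \<Rightarrow> ('a, 'n::finite) tensor \<Rightarrow> ('a, 'n) tensor" where
  "contraction a b T =
     (\<lambda>c I J. \<Sum>k\<in>UNIV. T c (take a I @ k # drop a I) (take b J @ k # drop b J))"

section \<open>Fields of bases of the tangent bundle\<close>

abbreviation tangent_space ::
  "'a topology \<Rightarrow> ('a, 'n::finite) chart set \<Rightarrow> 'a \<Rightarrow> ('a, 'n) tensor set" where
  "tangent_space M \<A> x \<equiv> tensors M \<A> 1 0 x"

definition basis_field ::
  "'a topology \<Rightarrow> ('a, 'n::finite) chart set \<Rightarrow> 'a set \<Rightarrow> ('n \<Rightarrow> 'a \<Rightarrow> ('a, 'n) tensor) \<Rightarrow> bool" where
  "basis_field M \<A> U E \<longleftrightarrow> openin M U \<and>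
     (\<forall>x\<in>U. (\<forall>i. E i x \<in> tangent_space M \<A> x) \<and>
            (\<forall>v\<in>tangent_space M \<A> x. \<exists>!a. v = lin_comb a (\<lambda>i. E i x)))"

text \<open>The vector of the coordinate basis of \<open>c\<close> belonging to the \<open>j\<close>-th coordinate, at \<open>x\<close>.\<close>

definition coord_basis ::
  "'a topology \<Rightarrow> ('a, 'n::finite) chart set \<Rightarrow> ('a, 'n) chart \<Rightarrow> 'n \<Rightarrow> 'a \<Rightarrow> ('a, 'n) tensor" where
  "coord_basis M \<A> c j x = (\<lambda>d I J.
     if d \<in> coords_at M \<A> x \<and> length I = 1 \<and> J = [] then jac d c x $ hd I $ j else 0)"

definition holonomic_on ::
  "'a topology \<Rightarrow> ('a, 'n::finite) chart set \<Rightarrow> 'a set \<Rightarrow> ('n \<Rightarrow> 'a \<Rightarrow> ('a, 'n) tensor) \<Rightarrow> bool" where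
  "holonomic_on M \<A> U E \<longleftrightarrow>
     (\<exists>c\<in>coords M \<A>. U \<subseteq> dom_of c \<and> (\<forall>x\<in>U. \<forall>j. E j x = coord_basis M \<A> c j x))"

section \<open>Flat linear transports\<close>

text \<open>\<open>L x y\<close> is the transport from \<open>x\<close> to \<open>y\<close>.\<close>

type_synonym ('a, 'n) transport = "'a \<Rightarrow> 'a \<Rightarrow> ('a, 'n) tensor \<Rightarrow> ('a, 'n) tensor"

definition flat_linear_transport ::
  "'a topology \<Rightarrow> ('a, 'n::finite) chart set \<Rightarrow> ('a, 'n) transport \<Rightarrow> bool" where
  "flat_linear_transport M \<A> L \<longleftrightarrow>
     (\<forall>x\<in>topspace M. \<forall>y\<in>topspace M. \<forall>p q.
        L x y ` tensors M \<A> p q x \<subseteq> tensors M \<A> p q y) \<and>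
     (\<forall>x\<in>topspace M. \<forall>y\<in>topspace M. \<forall>p q.
        \<forall>S\<in>tensors M \<A> p q x. \<forall>T\<in>tensors M \<A> p q x. \<forall>s t.
        L x y (lin_comb2 s S t T) = lin_comb2 s (L x y S) t (L x y T)) \<and>
     (\<forall>x\<in>topspace M. \<forall>y\<in>topspace M. \<forall>p q p' q'.
        \<forall>S\<in>tensors M \<A> p q x. \<forall>T\<in>tensors M \<A> p' q' x.
        L x y (tensor_prod p q S T) = tensor_prod p q (L x y S) (L x y T)) \<and>
     (\<forall>x\<in>topspace M. \<forall>y\<in>topspace M. \<forall>p q. \<forall>a\<le>p. \<forall>b\<le>q.
        \<forall>T\<in>tensors M \<A> (Suc p) (Suc q) x.
        L x y (contraction a b T) = contraction a b (L x y T)) \<and>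
     (\<forall>x\<in>topspace M. \<forall>y\<in>topspace M. \<forall>z\<in>topspace M. \<forall>p q. \<forall>T\<in>tensors M \<A> p q x.
        L y z (L x y T) = L x z T) \<and>
     (\<forall>x\<in>topspace M. \<forall>p q. \<forall>T\<in>tensors M \<A> p q x. L x x T = T)"

text \<open>The matrix of components of the bivector \<open>H(y,x)\<close> of \<open>L\<close> in the field of bases \<open>E\<close>.\<close>

definition bivector_comps ::
  "('a, 'n) transport \<Rightarrow> ('n::finite \<Rightarrow> 'a \<Rightarrow> ('a, 'n) tensor) \<Rightarrow> 'a \<Rightarrow> 'a \<Rightarrow> real ^ 'n ^ 'n" where
  "bivector_comps L E y x =
     (THE H. \<forall>j. L x y (E j x) = lin_comb (\<chi> i. H $ i $ j) (\<lambda>i. E i y))"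

definition C1_transport ::
  "'a topology \<Rightarrow> ('a, 'n::finite) chart set \<Rightarrow> ('a, 'n) transport \<Rightarrow> bool" where
  "C1_transport M \<A> L \<longleftrightarrow> (\<forall>c\<in>coords M \<A>. \<forall>i j.
     class_on 1 (\<lambda>(v, u). bivector_comps L (coord_basis M \<A> c) (point_of c v) (point_of c u) $ i $ j)
       (img_of c \<times> img_of c))"

definition constant_comps_on ::
  "('a, 'n) transport \<Rightarrow> ('n::finite \<Rightarrow> 'a \<Rightarrow> ('a, 'n) tensor) \<Rightarrow> 'a set \<Rightarrow> bool" where
  "constant_comps_on L E U \<longleftrightarrow> (\<exists>K. \<forall>x\<in>U. \<forall>y\<in>U. bivector_comps L E x y = K)"

text \<open>The matrices \<open>F x\<close> define \<open>L\<close> in the field of bases \<open>E\<close> over \<open>U\<close>.\<close>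

definition defines_transport ::
  "('a, 'n) transport \<Rightarrow> ('n::finite \<Rightarrow> 'a \<Rightarrow> ('a, 'n) tensor) \<Rightarrow> 'a set \<Rightarrow> ('a \<Rightarrow> real ^ 'n ^ 'n) \<Rightarrow> bool" where
  "defines_transport L E U F \<longleftrightarrow> (\<forall>x\<in>U. invertible (F x)) \<and>
     (\<forall>x\<in>U. \<forall>y\<in>U. bivector_comps L E y x = matrix_inv (F y) ** F x)"

definition partial_coord :: "('a, 'n::finite) chart \<Rightarrow> 'n \<Rightarrow> ('a \<Rightarrow> real) \<Rightarrow> 'a \<Rightarrow> real" where
  "partial_coord c k f x = frechet_derivative (f \<circ> point_of c) (at (map_of_chart c x)) (axis k 1)"

text \<open>Differentiability of \<open>F\<close> is not part of the condition: matrices defining a transport of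
  class C^1 in coordinates \<open>c\<close> satisfy \<open>F x = F z ** H(z,x)\<close> for fixed \<open>z\<close> and are therefore C^1.\<close>

definition integrability_condition ::
  "('a, 'n::finite) chart \<Rightarrow> ('a \<Rightarrow> real ^ 'n ^ 'n) \<Rightarrow> bool" where
  "integrability_condition c F \<longleftrightarrow> (\<forall>x\<in>dom_of c. \<forall>i j k.
     partial_coord c k (\<lambda>z. F z $ i $ j) x - partial_coord c j (\<lambda>z. F z $ i $ k) x = 0)"

end

theory Submission
  imports Defs
begin

text \<open>
  In coordinates \<open>c\<close> a flat transport is a matrix \<open>H(y,x) = F_y\<^sup>-\<^sup>1 F_x\<close>, and since
  \<open>H(x,x) = 1\<close>, its components in a field of bases are constant exactly if each basis vector is
  transported to the basis vector at the other point. If the basis at \<open>x\<close> has the columns of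
  \<open>B_x\<close> as components in \<open>c\<close>, this says that \<open>F_x B_x\<close> does not depend on \<open>x\<close>; so
  \<open>B_x = (D F_x)\<^sup>-\<^sup>1\<close> with an invertible constant \<open>D\<close>.

  Such a field is the coordinate basis of coordinates \<open>d\<close> exactly if the Jacobian matrix of
  \<open>d\<close> with respect to \<open>c\<close> is \<open>D F\<close>. The integrability condition says that the rows of
  \<open>F\<close>, hence those of \<open>D F\<close>, are closed one-forms. By the Poincare lemma
  (\<open>closed_one_form_exact_on_convex\<close>) they have primitives on a coordinate ball, and the
  inverse function theorem (\<open>Ck_local_inverse\<close>) makes these primitives local coordinates of
  class \<open>C\<^sup>2\<close>; this is \<open>coordinates_with_jacobian\<close>. Taking the given field of bases for
  \<open>B\<close> proves the last claim (\<open>constant_comps_basis_holonomic\<close>). The existence of a holonomic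
  field with constant components follows by applying it to the field obtained by transporting one
  basis from \<open>x\<^sub>0\<close> to all points nearby. Conversely, if the coordinate basis of \<open>c\<close>
  itself has constant components, then \<open>F = 1\<close> defines the transport in \<open>c\<close> and has
  vanishing derivatives.

  Any two choices of \<open>F\<close> differ by a constant left factor, which preserves the integrability
  condition, because \<open>F\<close> is as smooth as \<open>H\<close>. Hence the condition holds for all choices of
  \<open>F\<close> as soon as it holds for one.
\<close>

section \<open>Inverses and columns of square matrices\<close>

lemma
  fixes A :: "real ^ 'n ^ 'n"
  assumes "invertible A"
  shows matrix_inv_right: "A ** matrix_inv A = mat 1"
    and matrix_inv_left: "matrix_inv A ** A = mat 1"
  using someI_ex[OF assms[unfolded invertible_def]] unfolding matrix_inv_def by blast+

lemma matrix_inv_eqI: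
  fixes A B :: "real ^ 'n ^ 'n"
  assumes "A ** B = mat 1"
  shows "matrix_inv A = B"
proof -
  have "invertible A"
    using assms matrix_left_right_inverse unfolding invertible_def by blast
  then have "matrix_inv A ** (A ** B) = B"
    by (simp add: matrix_mul_assoc matrix_inv_left)
  then show ?thesis by (simp add: assms)
qed

text \<open>Cramer's rule. It exhibits the entries of the inverse as rational functions of the entries, which
is what carries smoothness over to inverse matrices.\<close>

lemma matrix_inv_component:
  fixes A :: "real ^ 'n ^ 'n"
  assumes "invertible A"
  shows "matrix_inv A $ k $ l = det (\<chi> i j. if j = k then axis l 1 $ i else A $ i $ j) * inverse (det A)"
proof -
  have "det A \<noteq> 0"
    using assms by (simp add: invertible_det_nz)
  moreover have "A *v (matrix_inv A *v axis l 1) = axis l 1"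
    by (simp add: matrix_vector_mul_assoc matrix_inv_right[OF assms])
  ultimately have "matrix_inv A *v axis l 1 = (\<chi> k. det (\<chi> i j. if j = k then axis l 1 $ i else A $ i $ j) / det A)"
    using cramer by blast
  from arg_cong[where f = "\<lambda>x. x $ k", OF this] show ?thesis
    by (simp add: matrix_vector_mult_basis column_def divide_inverse)
qed

lemma column_matrix_mult:
  fixes A :: "real ^ 'n ^ 'n"
  shows "column j (A ** B) = A *v column j B"
  by (simp add: vec_eq_iff column_def matrix_matrix_mult_def matrix_vector_mult_def)

lemma matrix_eq_columns: "A = B \<longleftrightarrow> (\<forall>j. column j A = column j B)"
  by (auto simp: vec_eq_iff column_def)

lemma column_mat_1: "column j (mat 1 :: real ^ 'n ^ 'n) = axis j 1"
  by (simp add: vec_eq_iff column_def mat_def axis_def)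

lemma invertible_mat_1: "invertible (mat 1 :: real ^ 'n ^ 'n)"
  unfolding invertible_def by (intro exI[of _ "mat 1"]) simp

lemma invertible_mult_vec_iff:
  fixes A :: "real ^ 'n ^ 'n"
  assumes "invertible A"
  shows "w = A *v v \<longleftrightarrow> v = matrix_inv A *v w"
  using matrix_inv_left[OF assms] matrix_inv_right[OF assms]
  by (metis matrix_vector_mul_assoc matrix_vector_mul_lid)

lemma invertible_mult_iff:
  fixes A :: "real ^ 'n ^ 'n"
  assumes "invertible A"
  shows "C = A ** B \<longleftrightarrow> B = matrix_inv A ** C"
  using matrix_inv_left[OF assms] matrix_inv_right[OF assms]
  by (metis matrix_mul_assoc matrix_mul_lid)

section \<open>Calculus of functions of class C^k\<close>

lemma Ck_on_cong:
  assumes "open S" "\<And>u. u \<in> S \<Longrightarrow> f u = g u" "Ck_on k f S"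
  shows "Ck_on k g S"
  using assms(2,3)
proof (induction k arbitrary: f g)
  case 0
  then show ?case by (simp cong: continuous_on_cong)
next
  case (Suc k)
  have D: "(g has_derivative frechet_derivative f (at u)) (at u)" if "u \<in> S" for u
  proof (rule has_derivative_transform_within_open[OF _ \<open>open S\<close> that])
    show "(f has_derivative frechet_derivative f (at u)) (at u)"
      by (rule frechet_derivative_works[THEN iffD1]) (use Suc.prems(2) that in simp)
  qed (use Suc.prems(1) in auto)
  have eq: "frechet_derivative f (at u) = frechet_derivative g (at u)" if "u \<in> S" for u
    using frechet_derivative_at[OF D[OF that]] .
  have "Ck_on k (\<lambda>u. frechet_derivative g (at u) v) S" for v
    by (rule Suc.IH[of "\<lambda>u. frechet_derivative f (at u) v"]) (use Suc.prems(2) eq in auto)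
  moreover have "g differentiable (at u)" if "u \<in> S" for u
    using D[OF that] by (rule differentiableI)
  ultimately show ?case by simp
qed

text \<open>A derivative given by a formula replaces \<^const>\<open>frechet_derivative\<close>, so that the
induction steps below never have to compute the latter.\<close>

lemma Ck_on_SucI:
  assumes "open S" "\<And>u. u \<in> S \<Longrightarrow> (f has_derivative f' u) (at u)"
    and "\<And>v. Ck_on k (\<lambda>u. f' u v) S"
  shows "Ck_on (Suc k) f S"
proof -
  have "Ck_on k (\<lambda>u. frechet_derivative f (at u) v) S" for v
    by (rule Ck_on_cong[OF assms(1) _ assms(3)]) (simp flip: frechet_derivative_at[OF assms(2)])
  moreover have "f differentiable (at u)" if "u \<in> S" for u
    using assms(2)[OF that] by (rule differentiableI)
  ultimately show ?thesis by simp
qed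

lemma Ck_on_SucD:
  assumes "Ck_on (Suc k) f S"
  shows "u \<in> S \<Longrightarrow> (f has_derivative frechet_derivative f (at u)) (at u)"
    and "Ck_on k (\<lambda>u. frechet_derivative f (at u) v) S"
proof -
  show "(f has_derivative frechet_derivative f (at u)) (at u)" if "u \<in> S"
    by (rule frechet_derivative_works[THEN iffD1]) (use assms that in simp)
  show "Ck_on k (\<lambda>u. frechet_derivative f (at u) v) S"
    using assms by simp
qed

lemma Ck_on_Suc_lower: "Ck_on (Suc k) f S \<Longrightarrow> Ck_on k f S"
proof (induction k arbitrary: f)
  case 0
  then show ?case
    by (auto intro!: continuous_at_imp_continuous_on differentiable_imp_continuous_within)
next
  case (Suc k)
  then show ?case by (metis Ck_on.simps(2))
qed

lemma Ck_on_mono: "Ck_on k f S \<Longrightarrow> j \<le> k \<Longrightarrow> Ck_on j f S"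
  by (induction k) (auto simp del: Ck_on.simps simp: le_Suc_eq dest: Ck_on_Suc_lower)

lemma class_on_nat_iff: "class_on (enat k) f S \<longleftrightarrow> Ck_on k f S"
  unfolding class_on_def by (auto intro: Ck_on_mono)

lemma Ck_on_subset: "Ck_on k f S \<Longrightarrow> T \<subseteq> S \<Longrightarrow> Ck_on k f T"
  by (induction k arbitrary: f) (auto intro: continuous_on_subset)

lemma Ck_on_locally:
  assumes "\<And>u. u \<in> S \<Longrightarrow> \<exists>T. open T \<and> u \<in> T \<and> Ck_on k f T"
  shows "Ck_on k f S"
  using assms
proof (induction k arbitrary: f)
  case 0
  then show ?case
    by (metis Ck_on.simps(1) continuous_at_imp_continuous_on continuous_on_eq_continuous_at)
next
  case (Suc k)
  have "Ck_on k (\<lambda>u. frechet_derivative f (at u) v) S" for v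
    by (rule Suc.IH) (use Suc.prems in fastforce)
  then show ?case using Suc.prems by fastforce
qed

lemma Ck_on_const: "open S \<Longrightarrow> Ck_on k (\<lambda>u. c) S"
proof (induction k arbitrary: c)
  case (Suc k)
  then show ?case by (intro Ck_on_SucI[where f' = "\<lambda>u v. 0"]) auto
qed simp

lemma Ck_on_bounded_linear_self:
  assumes "open S" "bounded_linear h"
  shows "Ck_on k h S"
proof (cases k)
  case 0
  then show ?thesis
    using assms by (auto intro: bounded_linear.continuous_on continuous_on_id)
next
  case (Suc j)
  then show ?thesis
    using assms by (auto simp del: Ck_on.simps intro!: Ck_on_SucI[where f' = "\<lambda>u. h"]
        bounded_linear_imp_has_derivative Ck_on_const)
qed

lemma Ck_on_bounded_linear:
  assumes "open S" "bounded_linear h" "Ck_on k f S"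
  shows "Ck_on k (\<lambda>u. h (f u)) S"
  using assms(3)
proof (induction k arbitrary: f)
  case 0
  then show ?case by (simp add: bounded_linear.continuous_on[OF assms(2)])
next
  case (Suc k)
  show ?case
    by (rule Ck_on_SucI[OF assms(1) bounded_linear.has_derivative[OF assms(2) Ck_on_SucD(1)[OF Suc.prems]]
          Suc.IH[OF Ck_on_SucD(2)[OF Suc.prems]]])
qed

lemma Ck_on_add:
  assumes "open S" "Ck_on k f S" "Ck_on k g S"
  shows "Ck_on k (\<lambda>u. f u + g u) S"
  using assms(2,3)
proof (induction k arbitrary: f g)
  case 0
  then show ?case by (simp add: continuous_on_add)
next
  case (Suc k)
  show ?case
    by (rule Ck_on_SucI[OF assms(1) has_derivative_add[OF Ck_on_SucD(1)[OF Suc.prems(1)] Ck_on_SucD(1)[OF Suc.prems(2)]]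
          Suc.IH[OF Ck_on_SucD(2)[OF Suc.prems(1)] Ck_on_SucD(2)[OF Suc.prems(2)]]])
qed

lemma Ck_on_sum:
  assumes "open S" "\<And>i. i \<in> I \<Longrightarrow> Ck_on k (f i) S"
  shows "Ck_on k (\<lambda>u. \<Sum>i\<in>I. f i u) S"
  using assms(2)
  by (induction I rule: infinite_finite_induct) (auto intro: Ck_on_const Ck_on_add assms(1))

lemma Ck_on_bounded_bilinear:
  assumes "open S" "bounded_bilinear B" "Ck_on k f S" "Ck_on k g S"
  shows "Ck_on k (\<lambda>u. B (f u) (g u)) S"
  using assms(3,4)
proof (induction k arbitrary: f g)
  case 0
  then show ?case by (simp add: bounded_bilinear.continuous_on[OF assms(2)])
next
  case (Suc k)
  note f = Ck_on_SucD[OF Suc.prems(1)] and g = Ck_on_SucD[OF Suc.prems(2)]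
  show ?case
  proof (rule Ck_on_SucI[OF assms(1)])
    show "((\<lambda>u. B (f u) (g u)) has_derivative
        (\<lambda>v. B (f u) (frechet_derivative g (at u) v) + B (frechet_derivative f (at u) v) (g u))) (at u)"
      if "u \<in> S" for u
      by (rule bounded_bilinear.FDERIV[OF assms(2) f(1)[OF that] g(1)[OF that]])
    show "Ck_on k (\<lambda>u. B (f u) (frechet_derivative g (at u) v) + B (frechet_derivative f (at u) v) (g u)) S" for v
      by (intro Ck_on_add assms(1) Suc.IH f(2) g(2) Suc.prems[THEN Ck_on_Suc_lower])
  qed
qed

lemmas Ck_on_mult = Ck_on_bounded_bilinear[OF _ bounded_bilinear_mult]

lemma Ck_on_prod:
  fixes f :: "'i \<Rightarrow> 'v::real_normed_vector \<Rightarrow> real"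
  assumes "open S" "\<And>i. i \<in> I \<Longrightarrow> Ck_on k (f i) S"
  shows "Ck_on k (\<lambda>u. \<Prod>i\<in>I. f i u) S"
  using assms(2)
  by (induction I rule: infinite_finite_induct) (auto intro: Ck_on_const Ck_on_mult assms(1))

lemma Ck_on_inverse:
  fixes f :: "'v::real_normed_vector \<Rightarrow> real"
  assumes "open S" "Ck_on k f S" "\<And>u. u \<in> S \<Longrightarrow> f u \<noteq> 0"
  shows "Ck_on k (\<lambda>u. inverse (f u)) S"
  using assms(2)
proof (induction k)
  case 0
  then show ?case using assms(3) by (auto intro: continuous_on_inverse)
next
  case (Suc k)
  note I = Suc.IH[OF Ck_on_Suc_lower[OF Suc.prems]]
  have m1: "Ck_on k (\<lambda>u. - 1) S" by (rule Ck_on_const[OF assms(1)])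
  have "Ck_on k (\<lambda>u. (- 1) * (inverse (f u) * frechet_derivative f (at u) v * inverse (f u))) S" for v
    by (intro Ck_on_mult m1 assms(1) I Ck_on_SucD(2)[OF Suc.prems])
  then show ?case
    by (intro Ck_on_SucI[OF assms(1) Deriv.has_derivative_inverse[OF assms(3) Ck_on_SucD(1)[OF Suc.prems]]]) auto
qed

text \<open>The chain rule, with the inner derivative expanded in the basis: this turns the derivative of the
composition into sums of products of functions to which the induction hypothesis applies.\<close>

lemma Ck_on_compose:
  fixes f :: "'u::real_normed_vector \<Rightarrow> 'v::euclidean_space"
    and g :: "'v \<Rightarrow> 'w::real_normed_vector"
  assumes "open S" "f ` S \<subseteq> T" "Ck_on k f S" "Ck_on k g T"
  shows "Ck_on k (\<lambda>u. g (f u)) S"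
  using assms(3,4)
proof (induction k arbitrary: g)
  case 0
  then show ?case using assms(2) by (auto intro: continuous_on_compose2)
next
  case (Suc k)
  note f = Ck_on_SucD[OF Suc.prems(1)] and g = Ck_on_SucD[OF Suc.prems(2)]
  define D where "D u v = (\<Sum>b\<in>Basis. (frechet_derivative f (at u) v \<bullet> b) *\<^sub>R frechet_derivative g (at (f u)) b)" for u v
  have "((\<lambda>u. g (f u)) has_derivative D u) (at u)" if "u \<in> S" for u
  proof -
    have G: "(g has_derivative frechet_derivative g (at (f u))) (at (f u))"
      using g(1) that assms(2) by blast
    have "frechet_derivative g (at (f u)) (frechet_derivative f (at u) v) = D u v" for v
      unfolding D_def
      by (subst (1) euclidean_representation[symmetric])
        (simp add: linear_sum[OF has_derivative_linear[OF G]] linear_cmul[OF has_derivative_linear[OF G]])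
    then show ?thesis
      using has_derivative_compose[OF f(1)[OF that] G] by simp
  qed
  moreover have "Ck_on k (\<lambda>u. D u v) S" for v
    unfolding D_def
    by (intro Ck_on_sum assms(1) Ck_on_bounded_bilinear[OF _ bounded_bilinear_scaleR]
        Ck_on_bounded_linear[OF _ bounded_linear_inner_left] f(2) Suc.IH g(2) Ck_on_Suc_lower[OF Suc.prems(1)])
  ultimately show ?case by (rule Ck_on_SucI[OF assms(1)])
qed

lemma Ck_on_vec_iff:
  fixes f :: "'u::real_normed_vector \<Rightarrow> 'w::real_normed_vector ^ 'n"
  assumes "open S"
  shows "Ck_on k f S \<longleftrightarrow> (\<forall>i. Ck_on k (\<lambda>u. f u $ i) S)"
proof safe
  fix i assume "Ck_on k f S"
  then show "Ck_on k (\<lambda>u. f u $ i) S"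
    by (rule Ck_on_bounded_linear[OF assms bounded_linear_vec_nth])
next
  assume *: "\<forall>i. Ck_on k (\<lambda>u. f u $ i) S"
  have "bounded_linear (axis i :: 'w \<Rightarrow> 'w ^ 'n)" for i
    by (rule bounded_linear_intro[where K = 1]) (auto simp: axis_def vec_eq_iff norm_vec_def L2_set_def if_distrib[where f = norm] if_distrib[where f = "\<lambda>x. x ^ 2"] cong: if_cong)
  then have "Ck_on k (\<lambda>u. \<Sum>i\<in>UNIV. axis i (f u $ i)) S"
    by (intro Ck_on_sum assms Ck_on_bounded_linear[where h = "axis _"]) (use * in auto)
  moreover have "(\<Sum>i\<in>UNIV. axis i (f u $ i)) = f u" for u
    by (simp add: vec_eq_iff axis_def if_distrib[where f = "\<lambda>x. x $ _"] cong: if_cong)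
  ultimately show "Ck_on k f S" by simp
qed

lemma Ck_on_det:
  fixes A :: "'u::real_normed_vector \<Rightarrow> real ^ 'n ^ 'n"
  assumes "open S" "\<And>i j. Ck_on k (\<lambda>u. A u $ i $ j) S"
  shows "Ck_on k (\<lambda>u. det (A u)) S"
  unfolding det_def by (intro Ck_on_sum Ck_on_mult Ck_on_const Ck_on_prod assms)

lemma Ck_on_matrix_inv:
  fixes A :: "'u::real_normed_vector \<Rightarrow> real ^ 'n ^ 'n"
  assumes "open S" "\<And>i j. Ck_on k (\<lambda>u. A u $ i $ j) S" "\<And>u. u \<in> S \<Longrightarrow> invertible (A u)"
  shows "Ck_on k (\<lambda>u. matrix_inv (A u) $ i $ j) S"
proof (rule Ck_on_cong[OF assms(1)])
  have "Ck_on k (\<lambda>u. (\<chi> a b. if b = i then axis j 1 $ a else A u $ a $ b) $ a $ b) S" for a b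
    using assms(2)[of a b] Ck_on_const[OF assms(1)] by (cases "b = i") auto
  moreover have "det (A u) \<noteq> 0" if "u \<in> S" for u
    using assms(3)[OF that] by (simp add: invertible_det_nz)
  ultimately show "Ck_on k (\<lambda>u. det (\<chi> a b. if b = i then axis j 1 $ a else A u $ a $ b) * inverse (det (A u))) S"
    by (intro Ck_on_mult Ck_on_det Ck_on_inverse assms)
qed (simp add: matrix_inv_component[OF assms(3)])

section \<open>The inverse function theorem in class C^k\<close>

text \<open>Bootstrapping: the derivative of \<open>h\<close> is a smooth function of \<open>h\<close> itself, so each order of
differentiability already known for \<open>h\<close> yields the next one, as far as \<open>f\<close> allows.\<close>

lemma Ck_on_inverse_map:
  fixes g h :: "real ^ 'n \<Rightarrow> real ^ 'n" and f :: "real ^ 'n \<Rightarrow> real ^ 'n ^ 'n"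
  assumes "open V" "continuous_on V h" "h ` V \<subseteq> W"
    and "\<And>y. y \<in> V \<Longrightarrow> (h has_derivative (\<lambda>v. matrix_inv (f (h y)) *v v)) (at y)"
    and "\<And>u. u \<in> W \<Longrightarrow> invertible (f u)"
    and "\<And>i j. Ck_on k (\<lambda>u. f u $ i $ j) W"
  shows "Ck_on (Suc k) h V"
proof -
  have "Ck_on j h V" if "j \<le> Suc k" for j
    using that
  proof (induction j)
    case 0
    then show ?case using assms(2) by simp
  next
    case (Suc j)
    have inv: "invertible (f (h y))" if "y \<in> V" for y
      using assms(3,5) that by blast
    have entries: "Ck_on j (\<lambda>y. f (h y) $ a $ b) V" for a b
      using Suc by (intro Ck_on_compose[OF assms(1,3) _ Ck_on_mono[OF assms(6)]]) auto
    have "Ck_on j (\<lambda>y. matrix_inv (f (h y)) *v v) V" for v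
      unfolding Ck_on_vec_iff[OF assms(1)] matrix_vector_mult_def
      by (auto intro!: Ck_on_sum Ck_on_mult Ck_on_const Ck_on_matrix_inv entries inv assms(1))
    then show ?case by (intro Ck_on_SucI[OF assms(1,4)]) auto
  qed
  then show ?thesis by blast
qed

text \<open>The Jacobian matrix of \<open>g\<close> is prescribed as \<open>f\<close>, so that the class of \<open>g\<close> and of its
inverse is controlled by the entries of \<open>f\<close> alone.\<close>

lemma Ck_local_inverse:
  fixes g :: "real ^ 'n \<Rightarrow> real ^ 'n" and f :: "real ^ 'n \<Rightarrow> real ^ 'n ^ 'n"
  assumes "open W" "u0 \<in> W"
    and der: "\<And>u. u \<in> W \<Longrightarrow> (g has_derivative (\<lambda>v. f u *v v)) (at u)"
    and inv: "\<And>u. u \<in> W \<Longrightarrow> invertible (f u)"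
    and Ck: "\<And>i j. Ck_on k (\<lambda>u. f u $ i $ j) W"
  obtains U V h where "open U" "U \<subseteq> W" "u0 \<in> U" "open V" "homeomorphism U V g h"
    "Ck_on (Suc k) g U" "Ck_on (Suc k) h V"
proof -
  have bl: "bounded_linear (\<lambda>v. A *v v)" for A :: "real ^ 'n ^ 'n"
    by (simp add: matrix_vector_mul_bounded_linear)
  have cont: "continuous_on W (\<lambda>u. Blinfun (\<lambda>v. f u *v v))"
  proof (rule continuous_on_blinfun_componentwise)
    fix b :: "real ^ 'n"
    have "Ck_on 0 (\<lambda>u. f u *v b) W"
      unfolding Ck_on_vec_iff[OF assms(1)] matrix_vector_mult_def
      by (auto intro!: Ck_on_sum Ck_on_mult Ck_on_const Ck_on_mono[OF Ck] assms(1) simp del: Ck_on.simps)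
    then show "continuous_on W (\<lambda>u. blinfun_apply (Blinfun (\<lambda>v. f u *v v)) b)"
      by (simp add: bounded_linear_Blinfun_apply[OF bl])
  qed
  have id: "Blinfun (\<lambda>v. matrix_inv (f u0) *v v) o\<^sub>L Blinfun (\<lambda>v. f u0 *v v) = id_blinfun"
    by (rule blinfun_eqI)
      (simp add: bounded_linear_Blinfun_apply[OF bl] matrix_vector_mul_assoc matrix_inv_left[OF inv[OF assms(2)]])
  obtain U V h h' where U: "open U" "U \<subseteq> W" "u0 \<in> U" and V: "open V" and hom: "homeomorphism U V g h"
    and h: "\<And>y. y \<in> V \<Longrightarrow> (h has_derivative (h' y)) (at y)"
    and h': "\<And>y. y \<in> V \<Longrightarrow> h' y = Hilbert_Choice.inv (blinfun_apply (Blinfun (\<lambda>v. f (h y) *v v)))"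
    using inverse_function_theorem[OF assms(1) _ cont assms(2) id, of g] der
    by (auto simp: bounded_linear_Blinfun_apply[OF bl]) metis
  have hV: "h ` V \<subseteq> U" using hom by (auto simp: homeomorphism_def)
  have h'_eq: "h' y = (\<lambda>v. matrix_inv (f (h y)) *v v)" if "y \<in> V" for y
  proof -
    have "invertible (f (h y))" using inv U(2) hV that by blast
    then show ?thesis
      unfolding h'[OF that] bounded_linear_Blinfun_apply[OF bl]
      by (intro inv_unique_comp)
        (auto simp: fun_eq_iff matrix_vector_mul_assoc matrix_inv_left matrix_inv_right)
  qed
  have "Ck_on (Suc k) g U"
  proof (rule Ck_on_SucI[OF U(1), where f' = "\<lambda>u v. f u *v v"])
    show "Ck_on k (\<lambda>u. f u *v v) U" for v
      unfolding Ck_on_vec_iff[OF U(1)] matrix_vector_mult_def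
      by (auto intro!: Ck_on_sum Ck_on_mult Ck_on_const Ck_on_subset[OF Ck U(2)] U(1))
  qed (use der U in auto)
  moreover have "Ck_on (Suc k) h V"
  proof (rule Ck_on_inverse_map[OF V _ hV])
    show "continuous_on V h" using hom by (simp add: homeomorphism_def)
  qed (use h h'_eq inv U(2) Ck_on_subset[OF Ck U(2)] in auto)
  ultimately show ?thesis using that[OF U V hom] by blast
qed

section \<open>Closed one-forms on convex open sets\<close>

text \<open>The Poincare lemma for one-forms, identified with vector fields by means of the inner product. The
primitive is the line integral of \<open>w\<close> along the segment from \<open>p\<close>. Differentiation under the
integral sign and the symmetry of the derivative of \<open>w\<close> turn the integrand of its derivative
in the direction \<open>v\<close> into the \<open>t\<close>-derivative of
\<open>t * (w (p + t *\<^sub>R (u - p)) \<bullet> v)\<close>.\<close>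

lemma closed_one_form_exact_on_convex:
  fixes w :: "'a::euclidean_space \<Rightarrow> 'a"
  assumes S: "open S" "convex S" "p \<in> S"
    and der: "\<And>u. u \<in> S \<Longrightarrow> (w has_derivative w' u) (at u)"
    and cont: "\<And>v. continuous_on S (\<lambda>u. w' u v)"
    and sym: "\<And>u v z. u \<in> S \<Longrightarrow> w' u v \<bullet> z = w' u z \<bullet> v"
  obtains \<phi> where "\<And>u. u \<in> S \<Longrightarrow> (\<phi> has_derivative (\<lambda>v. w u \<bullet> v)) (at u)"
proof -
  define \<gamma> where "\<gamma> u t = p + t *\<^sub>R (u - p)" for u and t :: real
  define \<phi> where "\<phi> u = integral (cbox 0 1) (\<lambda>t. w (\<gamma> u t) \<bullet> (u - p))" for u
  define D where "D u t = (\<lambda>v. w' (\<gamma> u t) (t *\<^sub>R v) \<bullet> (u - p) + w (\<gamma> u t) \<bullet> v)" for u t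
  have \<gamma>_in: "\<gamma> u t \<in> S" if "u \<in> S" "t \<in> cbox 0 1" for u t
  proof -
    have "(1 - t) *\<^sub>R p + t *\<^sub>R u \<in> S"
      using S that by (intro convexD) auto
    then show ?thesis by (simp add: \<gamma>_def algebra_simps)
  qed
  have w'_lin: "linear (w' u)" if "u \<in> S" for u
    using der[OF that] by (rule has_derivative_linear)
  have D_bl: "bounded_linear (D u t)" if "u \<in> S" "t \<in> cbox 0 1" for u t
  proof -
    have "bounded_linear (w' (\<gamma> u t))"
      using der[OF \<gamma>_in[OF that]] by (rule has_derivative_bounded_linear)
    then have "bounded_linear (\<lambda>v. w' (\<gamma> u t) (t *\<^sub>R v))"
      by (rule bounded_linear_compose[OF _ bounded_linear_scaleR_right])
    then show ?thesis
      unfolding D_def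
      by (rule bounded_linear_add[OF bounded_linear_compose[OF bounded_linear_inner_left] bounded_linear_inner_right])
  qed
  have D_apply: "blinfun_apply (Blinfun (D u t)) = D u t" if "u \<in> S" "t \<in> cbox 0 1" for u t
    by (rule bounded_linear_Blinfun_apply[OF D_bl[OF that]])
  have D_eq: "D u t v = t * (w' (\<gamma> u t) v \<bullet> (u - p)) + w (\<gamma> u t) \<bullet> v" if "u \<in> S" "t \<in> cbox 0 1" for u t v
    by (simp add: D_def linear_cmul[OF w'_lin[OF \<gamma>_in[OF that]]])
  have cont_w: "continuous_on S w"
    using der by (auto intro!: continuous_at_imp_continuous_on dest: has_derivative_continuous)
  have cont_\<gamma>: "continuous_on A (\<lambda>x. \<gamma> (fst x) (snd x))" for A
    unfolding \<gamma>_def by (intro continuous_intros)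
  have D_der: "((\<lambda>u. w (\<gamma> u t) \<bullet> (u - p)) has_derivative D u t) (at u within S)"
    if "u \<in> S" "t \<in> cbox 0 1" for u t
  proof -
    have "((\<lambda>u. \<gamma> u t) has_derivative (\<lambda>v. t *\<^sub>R v)) (at u within S)"
      unfolding \<gamma>_def by (auto intro!: derivative_eq_intros)
    then have "((\<lambda>u. w (\<gamma> u t)) has_derivative (\<lambda>v. w' (\<gamma> u t) (t *\<^sub>R v))) (at u within S)"
      using has_derivative_compose der[OF \<gamma>_in[OF that]] by blast
    then show ?thesis
      unfolding D_def by (auto intro!: derivative_eq_intros)
  qed
  have "continuous_on (S \<times> cbox 0 1) (\<lambda>x. Blinfun (D (fst x) (snd x)))"
  proof (rule continuous_on_blinfun_componentwise)
    fix b :: 'a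
    have "continuous_on (S \<times> cbox 0 1)
        (\<lambda>x. snd x * (w' (\<gamma> (fst x) (snd x)) b \<bullet> (fst x - p)) + w (\<gamma> (fst x) (snd x)) \<bullet> b)"
      by (intro continuous_intros continuous_on_compose2[OF cont cont_\<gamma>] continuous_on_compose2[OF cont_w cont_\<gamma>])
        (auto intro: \<gamma>_in)
    then show "continuous_on (S \<times> cbox 0 1) (\<lambda>x. blinfun_apply (Blinfun (D (fst x) (snd x))) b)"
      by (rule continuous_on_eq)
        (clarsimp simp: D_apply[simplified] D_eq[simplified])
  qed
  then have cont_D: "continuous_on (S \<times> cbox 0 1) (\<lambda>(u, t). Blinfun (D u t))"
    by (simp add: case_prod_unfold)
  have integrable: "(\<lambda>t. w (\<gamma> u t) \<bullet> (u - p)) integrable_on cbox 0 1" if "u \<in> S" for u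
    by (intro integrable_continuous continuous_intros continuous_on_compose2[OF cont_w, of _ "\<gamma> u"])
      (use \<gamma>_in that in \<open>auto simp: \<gamma>_def intro!: continuous_intros\<close>)
  have "(\<phi> has_derivative (\<lambda>v. w u \<bullet> v)) (at u)" if u: "u \<in> S" for u
  proof -
    have leibniz: "(\<phi> has_derivative integral (cbox 0 1) (\<lambda>t. Blinfun (D u t))) (at u within S)"
      unfolding \<phi>_def
      by (rule leibniz_rule[OF _ integrable cont_D u S(2)])
        (simp_all add: D_apply D_der)
    have apply_v: "blinfun_apply (integral (cbox 0 1) (\<lambda>t. Blinfun (D u t))) v = w u \<bullet> v" for v
    proof -
      have int: "(\<lambda>t. Blinfun (D u t)) integrable_on cbox 0 1"
        by (intro integrable_continuous continuous_on_compose2[OF cont_D, of _ "\<lambda>t. (u, t)", simplified] continuous_intros)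
          (use u in auto)
      \<comment> \<open>the symmetry of \<open>w'\<close> makes the integrand an exact \<open>t\<close>-derivative\<close>
      have der_t: "((\<lambda>t. t * (w (\<gamma> u t) \<bullet> v)) has_vector_derivative D u t v) (at t within {0..1})"
        if "t \<in> {0..1}" for t
      proof -
        have t: "t \<in> cbox 0 1" using that by simp
        have "(\<gamma> u has_derivative (\<lambda>h. h *\<^sub>R (u - p))) (at t within {0..1})"
          unfolding \<gamma>_def by (auto intro!: derivative_eq_intros)
        then have "((\<lambda>t. w (\<gamma> u t)) has_derivative (\<lambda>h. w' (\<gamma> u t) (h *\<^sub>R (u - p)))) (at t within {0..1})"
          using has_derivative_compose der[OF \<gamma>_in[OF u t]] by blast
        then have "((\<lambda>t. t * (w (\<gamma> u t) \<bullet> v)) has_derivative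
            (\<lambda>h. t * (w' (\<gamma> u t) (h *\<^sub>R (u - p)) \<bullet> v) + h * (w (\<gamma> u t) \<bullet> v))) (at t within {0..1})"
          by (auto intro!: derivative_eq_intros)
        moreover have "t * (w' (\<gamma> u t) (h *\<^sub>R (u - p)) \<bullet> v) + h * (w (\<gamma> u t) \<bullet> v) = h *\<^sub>R D u t v" for h
          unfolding linear_cmul[OF w'_lin[OF \<gamma>_in[OF u t]]] inner_scaleR_left
            sym[OF \<gamma>_in[OF u t], of "u - p" v] D_eq[OF u t]
          by (simp add: distrib_left mult.left_commute)
        ultimately show ?thesis by (simp add: has_vector_derivative_def)
      qed
      have "blinfun_apply (integral (cbox 0 1) (\<lambda>t. Blinfun (D u t))) v = integral (cbox 0 1) (\<lambda>t. D u t v)"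
        unfolding blinfun_apply_integral[OF int]
        by (rule integral_cong) (simp add: D_apply u)
      also have "\<dots> = 1 * (w (\<gamma> u 1) \<bullet> v) - 0 * (w (\<gamma> u 0) \<bullet> v)"
        using fundamental_theorem_of_calculus[OF _ der_t] by (intro integral_unique) auto
      finally show ?thesis by (simp add: \<gamma>_def)
    qed
    show ?thesis
      using has_derivative_eq_rhs[OF leibniz ext[OF apply_v]] by (simp add: at_within_open[OF u S(1)])
  qed
  then show ?thesis using that by blast
qed

section \<open>Charts and their Jacobian matrices\<close>

lemma class_on_2_iff: "class_on 2 f S \<longleftrightarrow> Ck_on 2 f S"
  using class_on_nat_iff[of 2 f S] by (simp add: numeral_eq_enat)

context
  fixes M :: "'a topology" and c :: "('a, 'n::finite) chart"
  assumes chart: "is_chart M c"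
begin

lemma chart_dom_subset: "dom_of c \<subseteq> topspace M"
  using chart openin_subset by (auto simp: is_chart_def)

lemma chart_homeomorphic_map:
  "homeomorphic_map (subtopology M (dom_of c)) (top_of_set (img_of c)) (map_of_chart c)"
  using chart by (simp add: is_chart_def)

lemma chart_inj_on: "inj_on (map_of_chart c) (dom_of c)"
  using chart_homeomorphic_map chart_dom_subset
  by (simp add: homeomorphic_map_def inf.absorb2)

lemma point_of_chart: "x \<in> dom_of c \<Longrightarrow> point_of c (map_of_chart c x) = x"
  unfolding point_of_def by (rule inv_into_f_f[OF chart_inj_on])

lemma chart_point_of: "u \<in> img_of c \<Longrightarrow> map_of_chart c (point_of c u) = u"
  unfolding point_of_def img_of_def by (rule f_inv_into_f)

lemma point_of_in_dom: "u \<in> img_of c \<Longrightarrow> point_of c u \<in> dom_of c"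
  unfolding point_of_def img_of_def by (rule inv_into_into)

lemma open_chart_image:
  assumes "openin M V" "V \<subseteq> dom_of c"
  shows "open (map_of_chart c ` V)"
proof -
  have "openin (top_of_set (img_of c)) (map_of_chart c ` V)"
    using homeomorphic_imp_open_map[OF chart_homeomorphic_map] assms
    by (auto simp: open_map_def openin_subtopology)
  then show ?thesis
    using chart openin_open_eq by (auto simp: is_chart_def)
qed

lemma openin_chart_preimage:
  assumes "open W"
  shows "openin M {x \<in> dom_of c. map_of_chart c x \<in> W}"
proof -
  have "openin (subtopology M (dom_of c))
      {x \<in> topspace (subtopology M (dom_of c)). map_of_chart c x \<in> img_of c \<inter> W}"
    using assms
    by (intro openin_continuous_map_preimage[OF homeomorphic_imp_continuous_map[OF chart_homeomorphic_map]])
      (auto simp: openin_open)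
  moreover have "{x \<in> topspace (subtopology M (dom_of c)). map_of_chart c x \<in> img_of c \<inter> W} =
      {x \<in> dom_of c. map_of_chart c x \<in> W}"
    using chart_dom_subset by (auto simp: img_of_def)
  ultimately show ?thesis
    using chart openin_trans_full by (fastforce simp: is_chart_def)
qed

end

lemma coordsD: "c \<in> coords M \<A> \<Longrightarrow> is_chart M c"
  and coords_atD: "c \<in> coords_at M \<A> x \<Longrightarrow> c \<in> coords M \<A>" "c \<in> coords_at M \<A> x \<Longrightarrow> x \<in> dom_of c"
  by (auto simp: coords_def coords_at_def)

lemma coords_atI: "c \<in> coords M \<A> \<Longrightarrow> x \<in> dom_of c \<Longrightarrow> c \<in> coords_at M \<A> x"
  by (simp add: coords_at_def)

lemma jac_eqI:
  assumes "((map_of_chart d \<circ> point_of c) has_derivative (\<lambda>v. B *v v)) (at (map_of_chart c x))"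
  shows "jac d c x = B"
  unfolding jac_def jacobian_def
  by (simp flip: frechet_derivative_at[OF assms])

text \<open>The charts of the atlas serve as intermediate coordinates at each point; how other coordinates fit
with them is expressed by \<^const>\<open>coords\<close>.\<close>

locale charted_space =
  fixes M :: "'a topology" and \<A> :: "('a, 'n::finite) chart set"
  assumes atlas_charts: "c \<in> \<A> \<Longrightarrow> is_chart M c"
    and atlas_covers: "x \<in> topspace M \<Longrightarrow> \<exists>c\<in>\<A>. x \<in> dom_of c"
begin

text \<open>Coordinates are by definition compatible with the atlas only; their compatibility with each other
follows by passing locally through a chart of the atlas.\<close>

lemma coords_transition:
  assumes c: "c \<in> coords M \<A>" and d: "d \<in> coords M \<A>"
  shows "Ck_on 2 (map_of_chart d \<circ> point_of c) (map_of_chart c ` (dom_of c \<inter> dom_of d))"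
proof (rule Ck_on_locally)
  note cc = coordsD[OF c] and dc = coordsD[OF d]
  fix u assume "u \<in> map_of_chart c ` (dom_of c \<inter> dom_of d)"
  then obtain x where x: "x \<in> dom_of c" "x \<in> dom_of d" "u = map_of_chart c x" by auto
  obtain a where a: "a \<in> \<A>" "x \<in> dom_of a"
    using atlas_covers x chart_dom_subset[OF cc] by blast
  note ac = atlas_charts[OF a(1)]
  define W where "W = dom_of c \<inter> dom_of d \<inter> dom_of a"
  define T where "T = map_of_chart c ` W"
  have "openin M W"
    using cc dc ac unfolding W_def by (auto simp: is_chart_def)
  then have T: "open T"
    unfolding T_def by (rule open_chart_image[OF cc]) (auto simp: W_def)
  have ca: "Ck_on 2 (map_of_chart a \<circ> point_of c) (map_of_chart c ` (dom_of c \<inter> dom_of a))"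
    using c a(1) by (simp add: coords_def compatible_def class_on_2_iff)
  have ad: "Ck_on 2 (map_of_chart d \<circ> point_of a) (map_of_chart a ` (dom_of d \<inter> dom_of a))"
    using d a(1) by (simp add: coords_def compatible_def class_on_2_iff)
  have "Ck_on 2 (\<lambda>u. (map_of_chart d \<circ> point_of a) ((map_of_chart a \<circ> point_of c) u)) T"
  proof (rule Ck_on_compose[OF T _ Ck_on_subset[OF ca] ad])
    show "(map_of_chart a \<circ> point_of c) ` T \<subseteq> map_of_chart a ` (dom_of d \<inter> dom_of a)"
      by (auto simp: T_def W_def point_of_chart[OF cc])
  qed (auto simp: T_def W_def)
  then have "Ck_on 2 (map_of_chart d \<circ> point_of c) T"
    by (rule Ck_on_cong[OF T, rotated])
      (auto simp: T_def W_def point_of_chart[OF cc] point_of_chart[OF ac])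
  moreover have "u \<in> T" using x a by (auto simp: T_def W_def)
  ultimately show "\<exists>T. open T \<and> u \<in> T \<and> Ck_on 2 (map_of_chart d \<circ> point_of c) T"
    using T by blast
qed

lemma transition_has_derivative:
  assumes c: "c \<in> coords_at M \<A> x" and d: "d \<in> coords_at M \<A> x"
  shows "((map_of_chart d \<circ> point_of c) has_derivative (\<lambda>v. jac d c x *v v)) (at (map_of_chart c x))"
proof -
  have "Ck_on (Suc 1) (map_of_chart d \<circ> point_of c) (map_of_chart c ` (dom_of c \<inter> dom_of d))"
    using coords_transition[OF coords_atD(1)[OF c] coords_atD(1)[OF d]] by (simp add: numeral_2_eq_2)
  then have "(map_of_chart d \<circ> point_of c) differentiable (at (map_of_chart c x))"
    using coords_atD(2)[OF c] coords_atD(2)[OF d] by simp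
  then show ?thesis
    unfolding jac_def by (simp add: jacobian_works)
qed

lemma jac_self: "c \<in> coords_at M \<A> x \<Longrightarrow> jac c c x = mat 1"
proof (rule jac_eqI)
  assume c: "c \<in> coords_at M \<A> x"
  note cc = coordsD[OF coords_atD(1)[OF c]]
  show "(map_of_chart c \<circ> point_of c has_derivative (*v) (mat 1)) (at (map_of_chart c x))"
  proof (rule has_derivative_transform_within_open)
    show "((\<lambda>u. u) has_derivative (*v) (mat 1)) (at (map_of_chart c x))"
      using has_derivative_ident by (rule has_derivative_eq_rhs) (simp add: fun_eq_iff)
    show "open (img_of c)" using cc by (simp add: is_chart_def)
    show "map_of_chart c x \<in> img_of c" using coords_atD(2)[OF c] by (simp add: img_of_def)
  qed (simp add: chart_point_of[OF cc])
qed

lemma jac_cocycle: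
  assumes c: "c \<in> coords_at M \<A> x" and d: "d \<in> coords_at M \<A> x" and e: "e \<in> coords_at M \<A> x"
  shows "jac e c x = jac e d x ** jac d c x"
proof (rule jac_eqI)
  note cc = coordsD[OF coords_atD(1)[OF c]] and dc = coordsD[OF coords_atD(1)[OF d]]
  note xs = coords_atD(2)[OF c] coords_atD(2)[OF d]
  let ?T = "map_of_chart c ` (dom_of c \<inter> dom_of d)"
  show "(map_of_chart e \<circ> point_of c has_derivative (*v) (jac e d x ** jac d c x)) (at (map_of_chart c x))"
  proof (rule has_derivative_transform_within_open)
    have "(map_of_chart d \<circ> point_of c) (map_of_chart c x) = map_of_chart d x"
      by (simp add: point_of_chart[OF cc] xs)
    then show "((\<lambda>u. (map_of_chart e \<circ> point_of d) ((map_of_chart d \<circ> point_of c) u)) has_derivative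
        (*v) (jac e d x ** jac d c x)) (at (map_of_chart c x))"
      using has_derivative_compose[OF transition_has_derivative[OF c d]] transition_has_derivative[OF d e]
      by (fastforce simp: matrix_vector_mul_assoc)
    show "open ?T"
      using cc dc by (intro open_chart_image[OF cc]) (auto simp: is_chart_def)
    show "map_of_chart c x \<in> ?T" using xs by auto
  qed (auto simp: point_of_chart[OF cc] point_of_chart[OF dc])
qed

lemma jac_inverse:
  assumes "c \<in> coords_at M \<A> x" "d \<in> coords_at M \<A> x"
  shows "jac c d x ** jac d c x = mat 1" "invertible (jac d c x)" "jac c d x = matrix_inv (jac d c x)"
proof -
  show *: "jac c d x ** jac d c x = mat 1"
    using jac_cocycle[OF assms(1,2,1)] jac_self[OF assms(1)] by simp
  then have **: "jac d c x ** jac c d x = mat 1"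
    using matrix_left_right_inverse by blast
  then show "invertible (jac d c x)" using * by (auto simp: invertible_def)
  show "jac c d x = matrix_inv (jac d c x)"
    using matrix_inv_eqI[OF **] by simp
qed

text \<open>This is used with the identity as \<open>g\<close>, to shrink the domain of coordinates, and with
primitives of the rows of \<open>F\<close> as components of \<open>g\<close>, to integrate \<open>F\<close>.\<close>

lemma coords_change:
  assumes c: "c \<in> coords M \<A>" and V: "openin M V" "V \<subseteq> dom_of c"
    and Y: "open Y" and hom: "homeomorphism (map_of_chart c ` V) Y g h"
    and g: "Ck_on 2 g (map_of_chart c ` V)" and h: "Ck_on 2 h Y"
  shows "(V, g \<circ> map_of_chart c) \<in> coords M \<A>"
proof -
  note cc = coordsD[OF c]
  let ?d = "(V, g \<circ> map_of_chart c)"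
  have img: "img_of ?d = Y"
    using hom by (auto simp: img_of_def homeomorphism_def image_comp)
  have VM: "V \<subseteq> topspace M" using V openin_subset by blast
  have hY: "h y \<in> map_of_chart c ` V" if "y \<in> Y" for y
    using hom that by (auto simp: homeomorphism_def)
  have map_dom: "map_of_chart c ` V \<subseteq> img_of c" using V by (auto simp: img_of_def)
  have map_hom: "homeomorphic_map (subtopology M V) (top_of_set (map_of_chart c ` V)) (map_of_chart c)"
  proof -
    have "homeomorphic_map (subtopology (subtopology M (dom_of c)) V)
        (subtopology (top_of_set (img_of c)) (map_of_chart c ` V)) (map_of_chart c)"
      using V VM map_dom chart_dom_subset[OF cc]
      by (intro homeomorphic_map_subtopologies[OF chart_homeomorphic_map[OF cc]])
        (auto simp: img_of_def)
    then show ?thesis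
      using V map_dom by (simp add: subtopology_subtopology inf.absorb2)
  qed
  have g_hom: "homeomorphic_map (top_of_set (map_of_chart c ` V)) (top_of_set Y) g"
    using hom by (auto simp: homeomorphic_map_maps homeomorphic_maps_def homeomorphism_def)
  have chart: "is_chart M ?d"
    unfolding is_chart_def img
    using V(1) Y homeomorphic_map_compose[OF map_hom g_hom] by simp
  have pt: "point_of ?d y = point_of c (h y)" if y: "y \<in> Y" for y
  proof -
    obtain x where x: "x \<in> V" "h y = map_of_chart c x" using hY[OF y] by auto
    have "y = map_of_chart ?d x" using hom y x(2) by (simp add: homeomorphism_def flip: x(2))
    then show ?thesis
      using point_of_chart[OF chart, of x] point_of_chart[OF cc, of x] x V(2) by auto
  qed
  have "compatible 2 ?d a" if a: "a \<in> \<A>" for a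
  proof -
    note ac = atlas_charts[OF a]
    have tr: "Ck_on 2 (map_of_chart a \<circ> point_of c) (map_of_chart c ` (dom_of c \<inter> dom_of a))"
      "Ck_on 2 (map_of_chart c \<circ> point_of a) (map_of_chart a ` (dom_of c \<inter> dom_of a))"
      using c a by (auto simp: coords_def compatible_def class_on_2_iff)
    have oVa: "openin M (V \<inter> dom_of a)" using V ac by (auto simp: is_chart_def)
    let ?T = "map_of_chart ?d ` (V \<inter> dom_of a)"
    let ?S = "map_of_chart a ` (V \<inter> dom_of a)"
    have T: "open ?T" using open_chart_image[OF chart oVa] by simp
    have S: "open ?S" using open_chart_image[OF ac oVa] by simp
    have TY: "?T \<subseteq> Y" using img by (auto simp: img_of_def)
    have hg: "h (g (map_of_chart c x)) = map_of_chart c x" if "x \<in> V" for x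
      using hom that by (simp add: homeomorphism_def)
    have "Ck_on 2 (\<lambda>y. (map_of_chart a \<circ> point_of c) (h y)) ?T"
      by (rule Ck_on_compose[OF T _ Ck_on_subset[OF h TY] tr(1)]) (use hg V(2) in auto)
    then have 1: "Ck_on 2 (map_of_chart a \<circ> point_of ?d) ?T"
      by (rule Ck_on_cong[OF T, rotated]) (use pt TY in auto)
    have "Ck_on 2 (\<lambda>y. g ((map_of_chart c \<circ> point_of a) y)) ?S"
      by (rule Ck_on_compose[OF S _ Ck_on_subset[OF tr(2)] g])
        (use V(2) point_of_chart[OF ac] in auto)
    then have 2: "Ck_on 2 (map_of_chart ?d \<circ> point_of a) ?S"
      by (simp add: o_def)
    show ?thesis using 1 2 by (simp add: compatible_def class_on_2_iff)
  qed
  then show ?thesis using chart by (simp add: coords_def)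
qed

lemma jac_coords_change:
  assumes c: "c \<in> coords_at M \<A> x" and V: "openin M V" "V \<subseteq> dom_of c" "x \<in> V"
    and g: "(g has_derivative (\<lambda>v. B *v v)) (at (map_of_chart c x))"
  shows "jac (V, g \<circ> map_of_chart c) c x = B"
proof (rule jac_eqI)
  note cc = coordsD[OF coords_atD(1)[OF c]]
  show "(map_of_chart (V, g \<circ> map_of_chart c) \<circ> point_of c has_derivative (*v) B) (at (map_of_chart c x))"
  proof (rule has_derivative_transform_within_open[OF g])
    show "open (img_of c)" using cc by (simp add: is_chart_def)
    show "map_of_chart c x \<in> img_of c" using coords_atD(2)[OF c] by (simp add: img_of_def)
  qed (simp add: chart_point_of[OF cc])
qed

end

section \<open>Tangent vectors in coordinates\<close>

definition tcomp :: "('a, 'n::finite) chart \<Rightarrow> ('a, 'n) tensor \<Rightarrow> real ^ 'n" where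
  "tcomp c T = (\<chi> i. T c [i] [])"

lemma tcomp_lin_comb2: "tcomp c (lin_comb2 s S t T) = s *\<^sub>R tcomp c S + t *\<^sub>R tcomp c T"
  by (simp add: vec_eq_iff tcomp_def lin_comb2_def)

context charted_space
begin

abbreviation "coords_around \<equiv> coords_at M \<A>"

text \<open>The tangent vector with given components. Together with \<open>tcomp\<close> it identifies tangent spaces
with \<open>real ^ 'n\<close>, so that fields of bases and transports become matrices.\<close>

definition tvec :: "('a, 'n) chart \<Rightarrow> 'a \<Rightarrow> real ^ 'n \<Rightarrow> ('a, 'n) tensor" where
  "tvec c x v = lin_comb v (\<lambda>i. coord_basis M \<A> c i x)"

lemma tvec_apply:
  "tvec c x v d I J = (if d \<in> coords_around x \<and> length I = 1 \<and> J = [] then (jac d c x *v v) $ hd I else 0)"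
  by (auto simp: tvec_def lin_comb_def coord_basis_def matrix_vector_mult_def mult.commute intro!: sum.neutral)

lemma coord_basis_eq_tvec: "coord_basis M \<A> c j x = tvec c x (axis j 1)"
  by (intro ext) (auto simp: tvec_apply coord_basis_def matrix_vector_mult_basis column_def)

text \<open>For type \<open>(1,0)\<close> the multi-indices of the transformation law are single indices, and the
covariant factor is an empty product.\<close>

lemma tangent_space_iff:
  "T \<in> tangent_space M \<A> x \<longleftrightarrow>
     (\<forall>c I J. \<not> (c \<in> coords_around x \<and> length I = 1 \<and> J = []) \<longrightarrow> T c I J = 0) \<and>
     (\<forall>c\<in>coords_around x. \<forall>d\<in>coords_around x. tcomp d T = jac d c x *v tcomp c T)"
proof -
  have lists1: "{K :: 'n list. length K = 1} = range (\<lambda>k. [k])"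
    by (auto simp: length_Suc_conv)
  have sum1: "(\<Sum>K | length K = 1. f K) = (\<Sum>k\<in>UNIV. f [k])" for f :: "'n list \<Rightarrow> real"
    unfolding lists1 by (subst sum.reindex) (auto simp: inj_def)
  have law: "(\<forall>I J. length I = 1 \<and> length J = 0 \<longrightarrow>
        T d I J = (\<Sum>K | length K = 1. \<Sum>R | length R = 0.
          (\<Prod>a<1. jac d c x $ (I ! a) $ (K ! a)) * (\<Prod>b<0. jac c d x $ (R ! b) $ (J ! b)) * T c K R)) \<longleftrightarrow>
      tcomp d T = jac d c x *v tcomp c T" for c d
    unfolding sum1 by (auto simp: vec_eq_iff tcomp_def matrix_vector_mult_def length_Suc_conv)
  show ?thesis
    unfolding tensors_def mem_Collect_eq law by simp
qed

lemma tcomp_tvec: "d \<in> coords_around x \<Longrightarrow> tcomp d (tvec c x v) = jac d c x *v v"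
  by (simp add: tcomp_def tvec_apply)

lemma tcomp_tvec_same: "c \<in> coords_around x \<Longrightarrow> tcomp c (tvec c x v) = v"
  by (simp add: tcomp_tvec jac_self)

lemma tvec_in_tangent_space:
  assumes "c \<in> coords_around x"
  shows "tvec c x v \<in> tangent_space M \<A> x"
  unfolding tangent_space_iff using assms
  by (auto simp: tcomp_tvec matrix_vector_mul_assoc simp flip: jac_cocycle)
    (auto simp: tvec_apply)

lemma tvec_tcomp:
  assumes "c \<in> coords_around x" "T \<in> tangent_space M \<A> x"
  shows "tvec c x (tcomp c T) = T"
proof (intro ext)
  fix d I J
  show "tvec c x (tcomp c T) d I J = T d I J"
  proof (cases "d \<in> coords_around x \<and> length I = 1 \<and> J = []")
    case True
    then obtain i where "I = [i]" by (auto simp: length_Suc_conv)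
    moreover have "jac d c x *v tcomp c T = tcomp d T"
      using assms True unfolding tangent_space_iff by metis
    ultimately show ?thesis
      using True by (simp add: tvec_apply) (simp add: tcomp_def)
  next
    case False
    then show ?thesis using assms(2) unfolding tangent_space_iff tvec_apply by metis
  qed
qed

lemma tvec_change:
  assumes "c \<in> coords_around x" "d \<in> coords_around x"
  shows "tvec d x v = tvec c x (jac c d x *v v)"
  using tvec_tcomp[OF assms(1) tvec_in_tangent_space[OF assms(2)]] tcomp_tvec[OF assms(1)] by metis

lemma lin_comb_tvec: "lin_comb a (\<lambda>j. tvec c x (column j B)) = tvec c x (B *v a)"
proof (intro ext)
  fix d I J
  have "(\<Sum>j\<in>UNIV. a $ j * (jac d c x *v column j B) $ i) = (jac d c x *v (B *v a)) $ i" for i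
  proof -
    have "(\<Sum>j\<in>UNIV. a $ j *\<^sub>R (jac d c x *v column j B)) = jac d c x *v (B *v a)"
      by (simp add: matrix_mult_sum[of B] linear_sum[OF matrix_vector_mul_linear]
          linear_cmul[OF matrix_vector_mul_linear] scalar_mult_eq_scaleR)
    from arg_cong[where f = "\<lambda>v. v $ i", OF this] show ?thesis by simp
  qed
  then show "lin_comb a (\<lambda>j. tvec c x (column j B)) d I J = tvec c x (B *v a) d I J"
    by (auto simp: lin_comb_def tvec_apply intro!: sum.neutral)
qed

text \<open>Every vector is a combination of the basis vectors, so multiplication by the matrix of their
components is surjective, hence invertible.\<close>

lemma basis_field_matrix:
  assumes "basis_field M \<A> U E" "x \<in> U" "c \<in> coords_around x"
  obtains B where "invertible B" "\<And>j. E j x = tvec c x (column j B)"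
proof -
  define B where "B = (\<chi> i j. tcomp c (E j x) $ i)"
  have col: "column j B = tcomp c (E j x)" for j
    by (simp add: B_def column_def)
  have E: "E j x = tvec c x (column j B)" for j
    using assms tvec_tcomp[OF assms(3)] unfolding basis_field_def col by metis
  have "\<exists>a. B *v a = w" for w
  proof -
    obtain a where "tvec c x w = lin_comb a (\<lambda>i. E i x)"
      using assms tvec_in_tangent_space[OF assms(3)] unfolding basis_field_def by metis
    then have "tvec c x w = tvec c x (B *v a)" by (simp add: E lin_comb_tvec)
    then show ?thesis using tcomp_tvec_same[OF assms(3)] by metis
  qed
  then have "\<exists>B'. B ** B' = mat 1"
    unfolding matrix_right_invertible_surjective surj_def by metis
  then have "invertible B"
    unfolding invertible_def using matrix_left_right_inverse by blast
  then show ?thesis using E that by blast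
qed

lemma basis_fieldI:
  assumes "openin M U"
    and "\<And>x. x \<in> U \<Longrightarrow> c \<in> coords_around x"
    and "\<And>x. x \<in> U \<Longrightarrow> invertible (B x)"
    and "\<And>x j. x \<in> U \<Longrightarrow> E j x = tvec c x (column j (B x))"
  shows "basis_field M \<A> U E"
  unfolding basis_field_def
proof (intro conjI ballI allI)
  fix x j assume x: "x \<in> U"
  show "E j x \<in> tangent_space M \<A> x"
    using assms(4)[OF x] tvec_in_tangent_space[OF assms(2)[OF x]] by simp
next
  fix x T assume x: "x \<in> U" and T: "T \<in> tangent_space M \<A> x"
  have "T = lin_comb a (\<lambda>j. E j x) \<longleftrightarrow> tcomp c T = B x *v a" for a
    unfolding assms(4)[OF x] lin_comb_tvec
    using tvec_tcomp[OF assms(2)[OF x] T] tcomp_tvec_same[OF assms(2)[OF x]] by metis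
  then show "\<exists>!a. T = lin_comb a (\<lambda>j. E j x)"
    using invertible_mult_vec_iff[OF assms(3)[OF x]] by simp
qed (rule assms(1))

lemma basis_field_subset:
  "basis_field M \<A> U E \<Longrightarrow> openin M V \<Longrightarrow> V \<subseteq> U \<Longrightarrow> basis_field M \<A> V E"
  unfolding basis_field_def by blast

end

section \<open>The matrix of a flat linear transport\<close>

locale flat_transport = charted_space M \<A>
  for M :: "'a topology" and \<A> :: "('a, 'n::finite) chart set" +
  fixes L :: "('a, 'n) transport"
  assumes flat: "flat_linear_transport M \<A> L"
begin

text \<open>The conditions on a flat linear transport, specialised to tangent vectors: the bivector is determined by
the transport of these.\<close>

lemma
  assumes "x \<in> topspace M" "y \<in> topspace M"
  shows transport_tangent: "T \<in> tangent_space M \<A> x \<Longrightarrow> L x y T \<in> tangent_space M \<A> y"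
    and transport_lin_comb2: "S \<in> tangent_space M \<A> x \<Longrightarrow> T \<in> tangent_space M \<A> x \<Longrightarrow>
      L x y (lin_comb2 s S t T) = lin_comb2 s (L x y S) t (L x y T)"
    and transport_trans: "z \<in> topspace M \<Longrightarrow> T \<in> tangent_space M \<A> x \<Longrightarrow> L y z (L x y T) = L x z T"
    and transport_self: "T \<in> tangent_space M \<A> x \<Longrightarrow> L x x T = T"
proof -
  note conds = flat[unfolded flat_linear_transport_def]
  show "L x y T \<in> tangent_space M \<A> y" if "T \<in> tangent_space M \<A> x"
    using conds[THEN conjunct1, rule_format, OF assms, THEN subsetD, OF imageI, OF that] .
  show "L x y (lin_comb2 s S t T) = lin_comb2 s (L x y S) t (L x y T)"
    if "S \<in> tangent_space M \<A> x" "T \<in> tangent_space M \<A> x"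
    using conds[THEN conjunct2, THEN conjunct1, rule_format, OF assms that] .
  show "L y z (L x y T) = L x z T" if "z \<in> topspace M" "T \<in> tangent_space M \<A> x"
    using conds[THEN conjunct2, THEN conjunct2, THEN conjunct2, THEN conjunct2, THEN conjunct1,
        rule_format, OF assms that] .
  show "L x x T = T" if "T \<in> tangent_space M \<A> x"
    using conds[THEN conjunct2, THEN conjunct2, THEN conjunct2, THEN conjunct2, THEN conjunct2,
        rule_format, OF assms(1) that] .
qed

lemma coords_around_topspace: "c \<in> coords_around x \<Longrightarrow> x \<in> topspace M"
  by (rule subsetD[OF chart_dom_subset[OF coordsD[OF coords_atD(1)]] coords_atD(2)])

text \<open>The components of the bivector in the coordinates \<open>c\<close>, introduced as the matrix of a linear map,
so that the composition laws of \<open>L\<close> become identities between matrices.\<close>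

definition transport_matrix :: "('a, 'n) chart \<Rightarrow> 'a \<Rightarrow> 'a \<Rightarrow> real ^ 'n ^ 'n" where
  "transport_matrix c y x = matrix (\<lambda>v. tcomp c (L x y (tvec c x v)))"

lemma transport_tvec:
  assumes c: "c \<in> coords_around x" "c \<in> coords_around y"
  shows "L x y (tvec c x v) = tvec c y (transport_matrix c y x *v v)"
proof -
  let ?\<Phi> = "\<lambda>v. tcomp c (L x y (tvec c x v))"
  note top = c[THEN coords_around_topspace]
  have comb: "?\<Phi> (s *\<^sub>R v + t *\<^sub>R w) = s *\<^sub>R ?\<Phi> v + t *\<^sub>R ?\<Phi> w" for s t v w
  proof -
    have "tvec c x (s *\<^sub>R v + t *\<^sub>R w) = lin_comb2 s (tvec c x v) t (tvec c x w)"
      by (intro ext) (simp add: tvec_apply lin_comb2_def matrix_vector_right_distrib matrix_vector_mult_scaleR)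
    then show ?thesis
      by (simp add: transport_lin_comb2[OF top tvec_in_tangent_space[OF c(1)] tvec_in_tangent_space[OF c(1)]]
          tcomp_lin_comb2)
  qed
  have "linear ?\<Phi>"
    using comb[of 1 _ 1] comb[of _ _ 0] by (intro linearI) simp_all
  then have "transport_matrix c y x *v v = ?\<Phi> v"
    unfolding transport_matrix_def by (intro matrix_works) (simp add: linear_matrix_vector_mul_eq)
  then show ?thesis
    using tvec_tcomp[OF c(2) transport_tangent[OF top tvec_in_tangent_space[OF c(1)]]] by simp
qed

lemma tvec_inject: "c \<in> coords_around x \<Longrightarrow> tvec c x v = tvec c x w \<longleftrightarrow> v = w"
  using tcomp_tvec_same by metis

lemma transport_matrix_trans:
  assumes c: "c \<in> coords_around x" "c \<in> coords_around y" "c \<in> coords_around z"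
  shows "transport_matrix c z y ** transport_matrix c y x = transport_matrix c z x"
proof -
  have "L y z (L x y (tvec c x v)) = L x z (tvec c x v)" for v
    using c by (intro transport_trans tvec_in_tangent_space coords_around_topspace)
  then show ?thesis
    using c by (simp add: transport_tvec tvec_inject matrix_vector_mul_assoc matrix_eq)
qed

lemma transport_matrix_self: "c \<in> coords_around x \<Longrightarrow> transport_matrix c x x = mat 1"
  using transport_self[OF coords_around_topspace coords_around_topspace tvec_in_tangent_space]
  by (simp add: transport_tvec tvec_inject matrix_eq)

lemma transport_matrix_inverse:
  assumes "c \<in> coords_around x" "c \<in> coords_around y"
  shows "matrix_inv (transport_matrix c y x) = transport_matrix c x y" "invertible (transport_matrix c y x)"
  using transport_matrix_trans[OF assms assms(1)] transport_matrix_trans[OF assms(2,1,2)]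
    transport_matrix_self assms
  by (auto simp: invertible_def intro!: matrix_inv_eqI)

text \<open>The change-of-basis formula for the bivector. Uniqueness of the matrix in the definition of
\<^const>\<open>bivector_comps\<close> is the invertibility of \<open>B\<close>.\<close>

lemma bivector_comps_eq:
  assumes c: "c \<in> coords_around x" "c \<in> coords_around y"
    and E: "\<And>j. E j x = tvec c x (column j A)" "\<And>j. E j y = tvec c y (column j B)"
    and B: "invertible B"
  shows "bivector_comps L E y x = matrix_inv B ** transport_matrix c y x ** A"
proof -
  have "(\<forall>j. L x y (E j x) = lin_comb (\<chi> i. H $ i $ j) (\<lambda>i. E i y)) \<longleftrightarrow>
      transport_matrix c y x ** A = B ** H" for H
  proof -
    have "(\<chi> i. H $ i $ j) = column j H" for j by (simp add: column_def)
    then show ?thesis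
      unfolding E lin_comb_tvec transport_tvec[OF c] tvec_inject[OF c(2)] matrix_eq_columns[of "_ ** A"]
        column_matrix_mult by simp
  qed
  then show ?thesis
    unfolding bivector_comps_def invertible_mult_iff[OF B] by (simp add: matrix_mul_assoc)
qed

lemma bivector_comps_coord_basis:
  assumes "c \<in> coords_around x" "c \<in> coords_around y"
  shows "bivector_comps L (coord_basis M \<A> c) y x = transport_matrix c y x"
proof -
  have "matrix_inv (mat 1 :: real ^ 'n ^ 'n) = mat 1" by (rule matrix_inv_eqI) simp
  then show ?thesis
    using bivector_comps_eq[OF assms, of "coord_basis M \<A> c" "mat 1" "mat 1"]
    by (simp add: coord_basis_eq_tvec column_mat_1 invertible_mat_1)
qed

text \<open>The components at \<open>(x,x)\<close> are those of the identity, so the only possible constant is the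
unit matrix.\<close>

lemma constant_comps_on_iff:
  assumes "basis_field M \<A> U E"
  shows "constant_comps_on L E U \<longleftrightarrow> (\<forall>x\<in>U. \<forall>y\<in>U. bivector_comps L E y x = mat 1)"
proof -
  have "bivector_comps L E x x = mat 1" if x: "x \<in> U" for x
  proof -
    have xM: "x \<in> topspace M" using assms x openin_subset unfolding basis_field_def by blast
    have E: "E j x \<in> tangent_space M \<A> x" for j
      using assms x by (simp add: basis_field_def)
    have uniq: "\<exists>!a. E j x = lin_comb a (\<lambda>i. E i x)" for j
      using assms x E unfolding basis_field_def by blast
    have unit: "E j x = lin_comb (\<chi> i. (mat 1 :: real ^ 'n ^ 'n) $ i $ j) (\<lambda>i. E i x)" for j
      by (intro ext) (simp add: lin_comb_def mat_def if_distrib[where f = "\<lambda>t. t * _"] cong: if_cong)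
    show ?thesis
      unfolding bivector_comps_def transport_self[OF xM xM E]
    proof (rule the_equality)
      fix H :: "real ^ 'n ^ 'n"
      assume H: "\<forall>j. E j x = lin_comb (\<chi> i. H $ i $ j) (\<lambda>i. E i x)"
      have "(\<chi> i. H $ i $ j) = (\<chi> i. (mat 1 :: real ^ 'n ^ 'n) $ i $ j)" for j
        using uniq[of j] unit[of j] H by blast
      then show "H = mat 1" by (simp add: vec_eq_iff)
    qed (use unit in blast)
  qed
  then show ?thesis unfolding constant_comps_on_def by metis
qed

lemma defines_transport_iff:
  assumes "c \<in> coords M \<A>"
  shows "defines_transport L (coord_basis M \<A> c) (dom_of c) F \<longleftrightarrow>
    (\<forall>x\<in>dom_of c. invertible (F x)) \<and>
    (\<forall>x\<in>dom_of c. \<forall>y\<in>dom_of c. transport_matrix c y x = matrix_inv (F y) ** F x)"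
  unfolding defines_transport_def
  using bivector_comps_coord_basis coords_atI[OF assms] by (metis (no_types, lifting))

text \<open>By transitivity \<open>H(y,x) = H(y,z) H(z,x)\<close>, where \<open>H(y,z)\<close> is the inverse of
\<open>H(z,y)\<close>.\<close>

lemma defines_transport_exists:
  assumes "c \<in> coords_at M \<A> z"
  shows "defines_transport L (coord_basis M \<A> c) (dom_of c) (transport_matrix c z)"
proof -
  note around = coords_atI[OF coords_atD(1)[OF assms]]
  show ?thesis
    unfolding defines_transport_iff[OF coords_atD(1)[OF assms]]
    using transport_matrix_inverse transport_matrix_trans assms around by metis
qed

lemma defines_transport_unique:
  assumes c: "c \<in> coords_at M \<A> z"
    and F: "defines_transport L (coord_basis M \<A> c) (dom_of c) F"
    and G: "defines_transport L (coord_basis M \<A> c) (dom_of c) G"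
    and x: "x \<in> dom_of c"
  shows "G x = (G z ** matrix_inv (F z)) ** F x"
proof -
  note iff = defines_transport_iff[OF coords_atD(1)[OF c]]
  have z: "z \<in> dom_of c" using coords_atD(2)[OF c] .
  have "matrix_inv (G z) ** G x = matrix_inv (F z) ** F x"
    using F G x z unfolding iff by metis
  then have "G z ** (matrix_inv (G z) ** G x) = G z ** (matrix_inv (F z) ** F x)" by simp
  moreover have "G z ** matrix_inv (G z) = mat 1"
    using G z unfolding iff by (intro matrix_inv_right) blast
  ultimately show ?thesis by (simp add: matrix_mul_assoc)
qed

lemma defines_transport_left_mult:
  assumes c: "c \<in> coords M \<A>"
    and F: "defines_transport L (coord_basis M \<A> c) (dom_of c) F"
    and D: "invertible D"
  shows "defines_transport L (coord_basis M \<A> c) (dom_of c) (\<lambda>x. D ** F x)"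
proof -
  have inv: "invertible (D ** F x)" if "x \<in> dom_of c" for x
    using F that D unfolding defines_transport_iff[OF c] by (blast intro: invertible_mult)
  have "matrix_inv (D ** F y) ** (D ** F x) = matrix_inv (F y) ** F x" if xy: "x \<in> dom_of c" "y \<in> dom_of c" for x y
  proof -
    have Fy: "invertible (F y)" using F xy unfolding defines_transport_iff[OF c] by blast
    have "(D ** F y) ** (matrix_inv (F y) ** matrix_inv D) = D ** (F y ** matrix_inv (F y)) ** matrix_inv D"
      by (simp add: matrix_mul_assoc)
    also have "\<dots> = mat 1"
      using matrix_inv_right[OF Fy] matrix_inv_right[OF D] by simp
    finally have "matrix_inv (D ** F y) = matrix_inv (F y) ** matrix_inv D"
      by (rule matrix_inv_eqI)
    then have "matrix_inv (D ** F y) ** (D ** F x) = matrix_inv (F y) ** (matrix_inv D ** D) ** F x"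
      by (simp add: matrix_mul_assoc)
    then show ?thesis using matrix_inv_left[OF D] by simp
  qed
  then show ?thesis using F inv unfolding defines_transport_iff[OF c] by simp
qed

section \<open>Coordinates with a prescribed Jacobian matrix\<close>

lemma transport_matrix_C1:
  assumes C1: "C1_transport M \<A> L" and c: "c \<in> coords_at M \<A> z"
  shows "Ck_on 1 (\<lambda>u. transport_matrix c z (point_of c u) $ i $ j) (img_of c)"
proof -
  have cc: "is_chart M c" by (rule coordsD[OF coords_atD(1)[OF c]])
  have S: "open (img_of c)" using cc by (simp add: is_chart_def)
  have z: "z \<in> dom_of c" using coords_atD(2)[OF c] .
  let ?v = "map_of_chart c z"
  have v: "?v \<in> img_of c" using z by (simp add: img_of_def)
  have "class_on 1 (\<lambda>(v, u). bivector_comps L (coord_basis M \<A> c) (point_of c v) (point_of c u) $ i $ j)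
      (img_of c \<times> img_of c)"
    using C1 coords_atD(1)[OF c] unfolding C1_transport_def by blast
  then have H: "Ck_on 1 (\<lambda>(v, u). bivector_comps L (coord_basis M \<A> c) (point_of c v) (point_of c u) $ i $ j)
      (img_of c \<times> img_of c)"
    by (simp only: one_enat_def class_on_nat_iff)
  \<comment> \<open>a constant plus a bounded linear map\<close>
  have "Ck_on 1 (\<lambda>u. (?v, 0) + (0, u)) (img_of c)"
    by (intro Ck_on_add Ck_on_const Ck_on_bounded_linear_self S)
      (rule bounded_linear_Pair[OF bounded_linear_zero bounded_linear_ident])
  then have P: "Ck_on 1 (\<lambda>u. (?v, u)) (img_of c)" by simp
  have "Ck_on 1 (\<lambda>u. (\<lambda>(v, u). bivector_comps L (coord_basis M \<A> c) (point_of c v) (point_of c u) $ i $ j) (?v, u))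
      (img_of c)"
    by (rule Ck_on_compose[OF S _ P H]) (use v in auto)
  then show ?thesis
  proof (rule Ck_on_cong[OF S, rotated])
    fix u assume "u \<in> img_of c"
    then have "c \<in> coords_at M \<A> (point_of c u)"
      using coords_atI[OF coords_atD(1)[OF c]] point_of_in_dom[OF cc] by blast
    then show "(\<lambda>(v, u). bivector_comps L (coord_basis M \<A> c) (point_of c v) (point_of c u) $ i $ j) (?v, u) =
        transport_matrix c z (point_of c u) $ i $ j"
      using bivector_comps_coord_basis[OF _ c] by (simp add: point_of_chart[OF cc z])
  qed
qed

text \<open>Up to a constant left factor \<open>F\<close> is \<open>H(z,x)\<close>, which is of class \<open>C\<^sup>1\<close> by
assumption.\<close>

lemma defining_matrices_C1:
  assumes C1: "C1_transport M \<A> L" and c: "c \<in> coords_at M \<A> z"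
    and F: "defines_transport L (coord_basis M \<A> c) (dom_of c) F"
  shows "Ck_on 1 (\<lambda>u. F (point_of c u) $ i $ j) (img_of c)"
proof -
  have cc: "is_chart M c" by (rule coordsD[OF coords_atD(1)[OF c]])
  have S: "open (img_of c)" using cc by (simp add: is_chart_def)
  \<comment> \<open>the factor that \<open>defines_transport_unique\<close> yields\<close>
  define D where "D = F z ** matrix_inv (transport_matrix c z z)"
  have "Ck_on 1 (\<lambda>u. \<Sum>k\<in>UNIV. D $ i $ k * transport_matrix c z (point_of c u) $ k $ j) (img_of c)"
    by (intro Ck_on_sum Ck_on_mult Ck_on_const transport_matrix_C1[OF C1 c] S)
  then show ?thesis
  proof (rule Ck_on_cong[OF S, rotated])
    fix u assume "u \<in> img_of c"
    then have "F (point_of c u) = D ** transport_matrix c z (point_of c u)"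
      using defines_transport_unique[OF c defines_transport_exists[OF c] F] point_of_in_dom[OF cc]
      unfolding D_def by blast
    then show "(\<Sum>k\<in>UNIV. D $ i $ k * transport_matrix c z (point_of c u) $ k $ j) = F (point_of c u) $ i $ j"
      by (simp add: matrix_matrix_mult_def)
  qed
qed

text \<open>The condition is linear in \<open>F\<close>. That \<open>F\<close> is of class \<open>C\<^sup>1\<close>
matters here: \<^const>\<open>frechet_derivative\<close> is additive only on differentiable functions.\<close>

lemma integrability_condition_left_mult:
  assumes C1: "C1_transport M \<A> L" and c: "c \<in> coords M \<A>"
    and F: "defines_transport L (coord_basis M \<A> c) (dom_of c) F"
    and int: "integrability_condition c F"
    and G: "\<And>x. x \<in> dom_of c \<Longrightarrow> G x = D ** F x"
  shows "integrability_condition c G"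
proof -
  have cc: "is_chart M c" by (rule coordsD[OF c])
  have S: "open (img_of c)" using cc by (simp add: is_chart_def)
  have "partial_coord c k (\<lambda>z. G z $ i $ j) x = (\<Sum>l\<in>UNIV. D $ i $ l * partial_coord c k (\<lambda>z. F z $ l $ j) x)"
    if x: "x \<in> dom_of c" for i j k x
  proof -
    let ?u = "map_of_chart c x"
    let ?f = "\<lambda>l u. F (point_of c u) $ l $ j"
    have u: "?u \<in> img_of c" using x by (simp add: img_of_def)
    have "(?f l has_derivative frechet_derivative (?f l) (at ?u)) (at ?u)" for l
      using Ck_on_SucD(1)[OF defining_matrices_C1[OF C1 coords_atI[OF c x] F, unfolded One_nat_def] u] .
    then have "((\<lambda>u. \<Sum>l\<in>UNIV. D $ i $ l * ?f l u) has_derivative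
        (\<lambda>v. \<Sum>l\<in>UNIV. D $ i $ l * frechet_derivative (?f l) (at ?u) v)) (at ?u)"
      by (intro has_derivative_sum has_derivative_mult_right)
    then have "((\<lambda>z. G z $ i $ j) \<circ> point_of c has_derivative
        (\<lambda>v. \<Sum>l\<in>UNIV. D $ i $ l * frechet_derivative (?f l) (at ?u) v)) (at ?u)"
      by (rule has_derivative_transform_within_open[OF _ S u])
        (simp add: G[OF point_of_in_dom[OF cc]] matrix_matrix_mult_def)
    from frechet_derivative_at[OF this] show ?thesis
      by (simp add: partial_coord_def o_def fun_eq_iff)
  qed
  then show ?thesis
    using int by (simp add: integrability_condition_def)
qed

lemma integrability_condition_independent:
  assumes C1: "C1_transport M \<A> L" and c: "c \<in> coords_at M \<A> z"
    and F: "defines_transport L (coord_basis M \<A> c) (dom_of c) F" "integrability_condition c F"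
    and G: "defines_transport L (coord_basis M \<A> c) (dom_of c) G"
  shows "integrability_condition c G"
  by (rule integrability_condition_left_mult[OF C1 coords_atD(1)[OF c] F])
    (rule defines_transport_unique[OF c F(1) G])

text \<open>The integrability condition says that the derivatives of the rows of \<open>F\<close> are symmetric, that
is, the rows are closed one-forms on a ball in the coordinates \<open>c\<close>. Their primitives form a map
with the invertible Jacobian matrix \<open>F\<close>, which is a local diffeomorphism of class \<open>C\<^sup>2\<close>
because \<open>F\<close> is of class \<open>C\<^sup>1\<close>.\<close>

lemma coordinates_with_jacobian:
  assumes C1: "C1_transport M \<A> L" and c: "c \<in> coords_at M \<A> z"
    and F: "defines_transport L (coord_basis M \<A> c) (dom_of c) F"
    and int: "integrability_condition c F"
    and N: "openin M N" "z \<in> N"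
  obtains d where "d \<in> coords_at M \<A> z" "dom_of d \<subseteq> N \<inter> dom_of c"
    "\<And>x. x \<in> dom_of d \<Longrightarrow> jac d c x = F x"
proof -
  note cM = coords_atD(1)[OF c] and z = coords_atD(2)[OF c]
  have cc: "is_chart M c" by (rule coordsD[OF cM])
  define f where "f u = F (point_of c u)" for u
  define P where "P k i j u = frechet_derivative (\<lambda>u. f u $ i $ j) (at u) (axis k 1)" for k i j u
  let ?u0 = "map_of_chart c z"
  have "open (map_of_chart c ` (N \<inter> dom_of c))"
    using N cc by (intro open_chart_image[OF cc]) (auto simp: is_chart_def)
  then obtain r where r: "r > 0" "ball ?u0 r \<subseteq> map_of_chart c ` (N \<inter> dom_of c)"
    using N z by (meson IntI imageI openE)
  define W where "W = ball ?u0 r"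
  have W: "open W" "convex W" "?u0 \<in> W" using r by (auto simp: W_def)
  have W_sub: "W \<subseteq> map_of_chart c ` (N \<inter> dom_of c)" using r by (simp add: W_def)
  then have W_img: "W \<subseteq> img_of c" by (auto simp: img_of_def)
  have f_C1: "Ck_on (Suc 0) (\<lambda>u. f u $ i $ j) W" for i j
    using Ck_on_subset[OF defining_matrices_C1[OF C1 c F] W_img] by (simp add: f_def del: Ck_on.simps)
  have f_der: "((\<lambda>u. f u $ i $ j) has_derivative (\<lambda>v. \<Sum>k\<in>UNIV. v $ k * P k i j u)) (at u)"
    if "u \<in> W" for i j u
  proof -
    note D = Ck_on_SucD(1)[OF f_C1 that, of i j]
    have "frechet_derivative (\<lambda>u. f u $ i $ j) (at u) v = (\<Sum>k\<in>UNIV. v $ k * P k i j u)" for v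
      unfolding P_def
      by (subst (1) basis_expansion[symmetric])
        (simp add: linear_sum[OF has_derivative_linear[OF D]] linear_cmul[OF has_derivative_linear[OF D]]
          scalar_mult_eq_scaleR)
    then show ?thesis using has_derivative_eq_rhs[OF D] by (simp add: fun_eq_iff)
  qed
  have P_cont: "continuous_on W (P k i j)" for k i j
    using Ck_on_SucD(2)[OF f_C1] by (simp add: P_def)
  have P_sym: "P k i j u = P j i k u" if "u \<in> W" for i j k u
  proof -
    have "point_of c u \<in> dom_of c" "map_of_chart c (point_of c u) = u"
      using W_img that point_of_in_dom[OF cc] chart_point_of[OF cc] by blast+
    then show ?thesis
      using int unfolding integrability_condition_def partial_coord_def P_def f_def o_def
      by (metis eq_iff_diff_eq_0)
  qed
  have "\<exists>\<phi>. \<forall>u\<in>W. (\<phi> has_derivative (\<lambda>v. f u $ i \<bullet> v)) (at u)" for i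
  proof -
    define D where "D u v = (\<chi> j. \<Sum>k\<in>UNIV. v $ k * P k i j u)" for u v :: "real ^ 'n"
    have der: "((\<lambda>u. f u $ i) has_derivative D u) (at u)" if u: "u \<in> W" for u
      unfolding has_derivative_componentwise_within[of "\<lambda>u. f u $ i"] Basis_vec_def D_def
      by (auto simp: inner_axis f_der[OF u])
    have cont: "continuous_on W (\<lambda>u. D u v)" for v
      unfolding D_def by (intro continuous_on_vec_lambda continuous_intros P_cont)
    have sym: "D u v \<bullet> y = D u y \<bullet> v" if u: "u \<in> W" for u v y
    proof -
      have "D u v \<bullet> y = (\<Sum>j\<in>UNIV. \<Sum>k\<in>UNIV. v $ k * P k i j u * y $ j)"
        by (simp add: D_def inner_vec_def sum_distrib_right)
      also have "\<dots> = (\<Sum>k\<in>UNIV. \<Sum>j\<in>UNIV. v $ k * P k i j u * y $ j)"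
        by (rule sum.swap)
      also have "\<dots> = (\<Sum>k\<in>UNIV. \<Sum>j\<in>UNIV. y $ j * P j i k u * v $ k)"
        using P_sym[OF u] by (intro sum.cong refl) (metis mult.commute mult.left_commute)
      also have "\<dots> = D u y \<bullet> v"
        by (simp add: D_def inner_vec_def sum_distrib_right)
      finally show ?thesis .
    qed
    show ?thesis
      by (rule closed_one_form_exact_on_convex[OF W der cont sym]) blast+
  qed
  then obtain \<phi> where \<phi>: "\<And>i u. u \<in> W \<Longrightarrow> (\<phi> i has_derivative (\<lambda>v. f u $ i \<bullet> v)) (at u)"
    by metis
  define g where "g u = (\<chi> i. \<phi> i u)" for u
  have g_der: "(g has_derivative (\<lambda>v. f u *v v)) (at u)" if "u \<in> W" for u
    unfolding has_derivative_componentwise_within[of g] Basis_vec_def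
    using \<phi>[OF that] by (auto simp: inner_axis g_def matrix_vector_mul_component)
  have f_inv: "invertible (f u)" if "u \<in> W" for u
    using F point_of_in_dom[OF cc subsetD[OF W_img that]] by (simp add: defines_transport_def f_def)
  obtain U V h where U: "open U" "U \<subseteq> W" "?u0 \<in> U" and V: "open V" and hom: "homeomorphism U V g h"
    and Ck: "Ck_on (Suc (Suc 0)) g U" "Ck_on (Suc (Suc 0)) h V"
    by (rule Ck_local_inverse[OF W(1,3) g_der f_inv f_C1])
  define S where "S = {x \<in> dom_of c. map_of_chart c x \<in> U}"
  have S: "openin M S" "S \<subseteq> dom_of c" "z \<in> S"
    using openin_chart_preimage[OF cc U(1)] U(3) z by (auto simp: S_def)
  have S_img: "map_of_chart c ` S = U"
    using U(2) W_img by (auto simp: S_def img_of_def)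
  have S_N: "S \<subseteq> N"
  proof
    fix x assume x: "x \<in> S"
    then obtain y where y: "y \<in> N" "y \<in> dom_of c" "map_of_chart c x = map_of_chart c y"
      using U(2) W_sub by (fastforce simp: S_def)
    then have "x = y" using chart_inj_on[OF cc] x by (auto simp: S_def inj_on_def)
    then show "x \<in> N" using y by simp
  qed
  let ?d = "(S, g \<circ> map_of_chart c)"
  have "?d \<in> coords M \<A>"
    using coords_change[OF cM S(1,2) V, of g h] hom Ck by (simp add: S_img numeral_2_eq_2 del: Ck_on.simps)
  then have "?d \<in> coords_at M \<A> z" using S(3) by (simp add: coords_at_def)
  moreover have "jac ?d c x = F x" if x: "x \<in> S" for x
  proof (rule jac_coords_change[OF coords_atI[OF cM] S(1,2) x])
    show "x \<in> dom_of c" using x S(2) by blast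
    have "(g has_derivative (\<lambda>v. f (map_of_chart c x) *v v)) (at (map_of_chart c x))"
      using x U(2) by (intro g_der) (auto simp: S_def)
    then show "(g has_derivative (\<lambda>v. F x *v v)) (at (map_of_chart c x))"
      using point_of_chart[OF cc] x by (simp add: f_def S_def)
  qed
  ultimately show ?thesis using that[of ?d] S S_N by simp
qed

section \<open>Holonomic bases with constant components\<close>

text \<open>Constancy forces the basis at \<open>x\<close> to be the transported basis at \<open>z\<close>, so in the
coordinates \<open>c\<close> its matrix is \<open>F_x\<^sup>-\<^sup>1 F_z B_0\<close>, where \<open>B_0\<close> is the matrix
at \<open>z\<close>. Its inverse \<open>D F_x\<close> with \<open>D = (F_z B_0)\<^sup>-\<^sup>1\<close> also defines the
transport and is integrable, hence is the Jacobian matrix of new coordinates, and their coordinate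
basis is the given one.\<close>

lemma constant_comps_basis_holonomic:
  assumes C1: "C1_transport M \<A> L" and c: "c \<in> coords_at M \<A> z"
    and F: "defines_transport L (coord_basis M \<A> c) (dom_of c) F" "integrability_condition c F"
    and E: "basis_field M \<A> U E" "constant_comps_on L E U" and z: "z \<in> U"
  obtains V where "V \<subseteq> U" "openin M V" "z \<in> V" "holonomic_on M \<A> V E"
proof -
  note cM = coords_atD(1)[OF c]
  note F_iff = F(1)[unfolded defines_transport_iff[OF cM]]
  have UM: "openin M U" using E(1) by (simp add: basis_field_def)
  obtain B0 where B0: "invertible B0" "\<And>j. E j z = tvec c z (column j B0)"
    using basis_field_matrix[OF E(1) z c] by metis
  have E_eq: "E j x = tvec c x (column j (matrix_inv (F x) ** F z ** B0))" if x: "x \<in> U" "x \<in> dom_of c" for x j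
  proof -
    note cx = coords_atI[OF cM x(2)]
    obtain B where B: "invertible B" "\<And>j. E j x = tvec c x (column j B)"
      using basis_field_matrix[OF E(1) x(1) cx] by metis
    have "mat 1 = matrix_inv B ** (transport_matrix c x z ** B0)"
      using bivector_comps_eq[OF c cx, of E B0 B] B B0 E(2) x z
      unfolding constant_comps_on_iff[OF E(1)] by (simp add: matrix_mul_assoc)
    then have "transport_matrix c x z ** B0 = B"
      using invertible_mult_iff[OF B(1), of "transport_matrix c x z ** B0" "mat 1"] by (metis matrix_mul_rid)
    moreover have "transport_matrix c x z = matrix_inv (F x) ** F z"
      using F_iff x coords_atD(2)[OF c] by blast
    ultimately show ?thesis using B(2) by simp
  qed
  \<comment> \<open>the constant left factor for which the inverse of \<open>D ** F x\<close> has the components of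
    \<open>E\<close> at \<open>x\<close> as columns\<close>
  define D where "D = matrix_inv (F z ** B0)"
  have FB: "invertible (F z ** B0)"
    using F_iff coords_atD(2)[OF c] B0(1) by (blast intro: invertible_mult)
  have D: "invertible D"
    unfolding D_def invertible_def using matrix_inv_left[OF FB] matrix_inv_right[OF FB] by blast
  obtain d where d: "d \<in> coords_at M \<A> z" "dom_of d \<subseteq> U \<inter> dom_of c"
    "\<And>x. x \<in> dom_of d \<Longrightarrow> jac d c x = D ** F x"
    using coordinates_with_jacobian[OF C1 c defines_transport_left_mult[OF cM F(1) D]
        integrability_condition_left_mult[OF C1 cM F, of "\<lambda>x. D ** F x" D] UM z] by metis
  note dM = coords_atD(1)[OF d(1)]
  have "E j x = coord_basis M \<A> d j x" if x: "x \<in> dom_of d" for x j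
  proof -
    have xc: "x \<in> U" "x \<in> dom_of c" using d(2) x by auto
    note cx = coords_atI[OF cM xc(2)] and dx = coords_atI[OF dM x]
    have Fx: "invertible (F x)" using F_iff xc by blast
    have "(D ** F x) ** (matrix_inv (F x) ** (F z ** B0)) = D ** (F x ** matrix_inv (F x)) ** (F z ** B0)"
      by (simp add: matrix_mul_assoc)
    also have "\<dots> = mat 1"
      using matrix_inv_right[OF Fx] matrix_inv_left[OF FB] by (simp add: D_def)
    finally have "jac c d x = matrix_inv (F x) ** (F z ** B0)"
      unfolding jac_inverse(3)[OF cx dx] d(3)[OF x] by (rule matrix_inv_eqI)
    then show ?thesis
      unfolding coord_basis_eq_tvec tvec_change[OF cx dx] E_eq[OF xc]
      by (simp add: matrix_mul_assoc matrix_vector_mult_basis)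
  qed
  then have "holonomic_on M \<A> (dom_of d) E"
    unfolding holonomic_on_def using dM by blast
  moreover have "openin M (dom_of d)" using coordsD[OF dM] by (simp add: is_chart_def)
  ultimately show ?thesis using that d(2) coords_atD(2)[OF d(1)] by blast
qed

text \<open>Transporting one basis from \<open>z\<close> to all points gives a field of bases that every transport
respects, by transitivity.\<close>

lemma transported_basis_constant_comps:
  assumes c: "c \<in> coords_at M \<A> z"
  defines "E \<equiv> \<lambda>j x. L z x (coord_basis M \<A> c j z)"
  shows "basis_field M \<A> (dom_of c) E" "constant_comps_on L E (dom_of c)"
proof -
  note cM = coords_atD(1)[OF c]
  note around = coords_atI[OF cM]
  have E: "E j x = tvec c x (column j (transport_matrix c x z))" if "x \<in> dom_of c" for j x
    unfolding E_def coord_basis_eq_tvec transport_tvec[OF c around[OF that]]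
    by (simp add: matrix_vector_mult_basis)
  show bf: "basis_field M \<A> (dom_of c) E"
    using coordsD[OF cM] transport_matrix_inverse(2)[OF c around] around E
    by (intro basis_fieldI[where c = c and B = "\<lambda>x. transport_matrix c x z"]) (auto simp: is_chart_def)
  show "constant_comps_on L E (dom_of c)"
    unfolding constant_comps_on_iff[OF bf]
  proof (intro ballI)
    fix x y assume xy: "x \<in> dom_of c" "y \<in> dom_of c"
    note cx = around[OF xy(1)] and cy = around[OF xy(2)]
    show "bivector_comps L E y x = mat 1"
      using bivector_comps_eq[OF cx cy E[OF xy(1)] E[OF xy(2)] transport_matrix_inverse(2)[OF c cy]]
        transport_matrix_trans[OF c cx cy] matrix_inv_left[OF transport_matrix_inverse(2)[OF c cy]]
      by (simp flip: matrix_mul_assoc)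
  qed
qed

text \<open>The coordinates behind a holonomic field may have a larger domain than the field, but the defining
matrices have to work on the whole domain; therefore the coordinates are restricted to \<open>U\<close>.\<close>

lemma holonomic_constant_imp_integrable:
  assumes E: "basis_field M \<A> U E" "holonomic_on M \<A> U E" "constant_comps_on L E U" and z: "z \<in> U"
  obtains c where "c \<in> coords_at M \<A> z"
    "defines_transport L (coord_basis M \<A> c) (dom_of c) (\<lambda>x. mat 1)"
proof -
  obtain c where c: "c \<in> coords M \<A>" "U \<subseteq> dom_of c" "\<And>x j. x \<in> U \<Longrightarrow> E j x = coord_basis M \<A> c j x"
    using E(2) unfolding holonomic_on_def by blast
  have U: "openin M U" using E(1) by (simp add: basis_field_def)
  let ?c = "(U, (\<lambda>u. u) \<circ> map_of_chart c)"
  have op: "open (map_of_chart c ` U)" by (rule open_chart_image[OF coordsD[OF c(1)] U c(2)])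
  have cU: "?c \<in> coords M \<A>"
    by (rule coords_change[OF c(1) U c(2) op])
      (auto simp: homeomorphism_def intro: Ck_on_bounded_linear_self[OF op bounded_linear_ident])
  have basis: "coord_basis M \<A> ?c j x = E j x" if x: "x \<in> U" for j x
  proof -
    note cx = coords_atI[OF c(1), of x] and cUx = coords_atI[OF cU, of x]
    have xc: "x \<in> dom_of c" using c(2) x by blast
    have "((\<lambda>u. u) has_derivative (\<lambda>v. mat 1 *v v)) (at (map_of_chart c x))"
      using has_derivative_ident by (rule has_derivative_eq_rhs) (simp add: fun_eq_iff)
    then have "jac ?c c x = mat 1"
      using jac_coords_change[OF cx[OF xc] U c(2) x] by blast
    then have "jac c ?c x = mat 1"
      using jac_inverse(1)[OF cx[OF xc] cUx] x by simp
    then show ?thesis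
      using tvec_change[OF cx[OF xc] cUx] x by (simp add: coord_basis_eq_tvec c(3))
  qed
  have "bivector_comps L (coord_basis M \<A> ?c) y x = mat 1" if "x \<in> U" "y \<in> U" for x y
  proof -
    have "bivector_comps L (coord_basis M \<A> ?c) y x = bivector_comps L E y x"
      unfolding bivector_comps_def basis[OF that(1)] basis[OF that(2)] ..
    then show ?thesis using E(3) that unfolding constant_comps_on_iff[OF E(1)] by simp
  qed
  then have "defines_transport L (coord_basis M \<A> ?c) (dom_of ?c) (\<lambda>x. mat 1)"
    by (simp add: defines_transport_def invertible_mat_1 matrix_inv_eqI)
  moreover have "?c \<in> coords_at M \<A> z" using coords_atI[OF cU] z by simp
  ultimately show ?thesis using that by blast
qed

end

lemma integrability_condition_const: "integrability_condition c (\<lambda>x. A)"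
  by (simp add: integrability_condition_def partial_coord_def o_def)

theorem proposition4p2:
  fixes M :: "'a topology" and \<A> :: "('a, 'n::finite) chart set" and r :: enat
    and L :: "('a, 'n) transport" and x\<^sub>0 :: 'a
  assumes "manifold r M \<A>" and "2 \<le> r"
    and "flat_linear_transport M \<A> L" and "C1_transport M \<A> L"
    and "x\<^sub>0 \<in> topspace M"
  shows
    "((\<exists>U E. x\<^sub>0 \<in> U \<and> basis_field M \<A> U E \<and> holonomic_on M \<A> U E \<and> constant_comps_on L E U)
      \<longleftrightarrow>
      (\<exists>c\<in>coords_at M \<A> x\<^sub>0. \<exists>F.
         defines_transport L (coord_basis M \<A> c) (dom_of c) F \<and> integrability_condition c F))
     \<and>
     (\<forall>c\<in>coords_at M \<A> x\<^sub>0.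
        (\<exists>F. defines_transport L (coord_basis M \<A> c) (dom_of c) F) \<and>
        ((\<exists>F. defines_transport L (coord_basis M \<A> c) (dom_of c) F \<and> integrability_condition c F)
         \<longleftrightarrow>
         (\<forall>F. defines_transport L (coord_basis M \<A> c) (dom_of c) F \<longrightarrow> integrability_condition c F)))
     \<and>
     ((\<exists>c\<in>coords_at M \<A> x\<^sub>0. \<exists>F.
         defines_transport L (coord_basis M \<A> c) (dom_of c) F \<and> integrability_condition c F)
      \<longrightarrow>
      (\<forall>U E. x\<^sub>0 \<in> U \<and> basis_field M \<A> U E \<and> constant_comps_on L E U \<longrightarrow>
         (\<exists>V\<subseteq>U. openin M V \<and> x\<^sub>0 \<in> V \<and> holonomic_on M \<A> V E)))"
proof -
  interpret flat_transport M \<A> L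
    using assms(1,3) by unfold_locales (auto simp: manifold_def)
  note C1 = assms(4)
  let ?integrable = "\<lambda>c F. defines_transport L (coord_basis M \<A> c) (dom_of c) F \<and> integrability_condition c F"
  have holonomic: "\<exists>V\<subseteq>U. openin M V \<and> x\<^sub>0 \<in> V \<and> holonomic_on M \<A> V E"
    if "c \<in> coords_at M \<A> x\<^sub>0" "?integrable c F"
      "x\<^sub>0 \<in> U" "basis_field M \<A> U E" "constant_comps_on L E U" for c F U E
    using constant_comps_basis_holonomic[OF C1, of c x\<^sub>0 F U E] that by metis
  have holonomic_ex: "\<exists>U E. x\<^sub>0 \<in> U \<and> basis_field M \<A> U E \<and> holonomic_on M \<A> U E \<and> constant_comps_on L E U"
    if c: "c \<in> coords_at M \<A> x\<^sub>0" and F: "?integrable c F" for c F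
  proof -
    define E where "E = (\<lambda>j x. L x\<^sub>0 x (coord_basis M \<A> c j x\<^sub>0))"
    have E: "basis_field M \<A> (dom_of c) E" "constant_comps_on L E (dom_of c)"
      unfolding E_def by (rule transported_basis_constant_comps[OF c])+
    obtain V where V: "V \<subseteq> dom_of c" "openin M V" "x\<^sub>0 \<in> V" "holonomic_on M \<A> V E"
      using holonomic[OF c F coords_atD(2)[OF c] E] by blast
    have "constant_comps_on L E V"
      using E(2) V(1) unfolding constant_comps_on_def by blast
    then show ?thesis using basis_field_subset[OF E(1) V(2,1)] V by blast
  qed
  have integrable_ex: "\<exists>c\<in>coords_at M \<A> x\<^sub>0. \<exists>F. ?integrable c F"
    if "x\<^sub>0 \<in> U" "basis_field M \<A> U E" "holonomic_on M \<A> U E" "constant_comps_on L E U" for U E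
    by (rule holonomic_constant_imp_integrable[OF that(2,3,4,1)])
      (blast intro: integrability_condition_const)
  have independent: "(\<exists>F. defines_transport L (coord_basis M \<A> c) (dom_of c) F) \<and>
      ((\<exists>F. ?integrable c F) \<longleftrightarrow>
       (\<forall>F. defines_transport L (coord_basis M \<A> c) (dom_of c) F \<longrightarrow> integrability_condition c F))"
    if c: "c \<in> coords_at M \<A> x\<^sub>0" for c
    using defines_transport_exists[OF c] integrability_condition_independent[OF C1 c] by blast
  show ?thesis
  proof (intro conjI iffI)
    assume "\<exists>U E. x\<^sub>0 \<in> U \<and> basis_field M \<A> U E \<and> holonomic_on M \<A> U E \<and> constant_comps_on L E U"
    then show "\<exists>c\<in>coords_at M \<A> x\<^sub>0. \<exists>F. ?integrable c F"
      using integrable_ex by (elim exE conjE)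
  next
    assume "\<exists>c\<in>coords_at M \<A> x\<^sub>0. \<exists>F. ?integrable c F"
    then show "\<exists>U E. x\<^sub>0 \<in> U \<and> basis_field M \<A> U E \<and> holonomic_on M \<A> U E \<and> constant_comps_on L E U"
      using holonomic_ex by (elim exE bexE)
  qed (use independent holonomic in \<open>blast+\<close>)
qed

end
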